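(* Let $k_4:=|K_4(G)|$. Then: (a) $|\widetilde{K_4}(G)|=2|\overline{K_4}(G)|=2k_4$; (b) $|\widetilde{D}(G)|=2|D(G)|=2|\overline{D}(G)|=\frac{1}{64}q(q-1)(q-5)(q-9)-12k_4$; (c) $|\widetilde{R}(G)|=2|R(G)|=2|\overline{R}(G)|=\frac14 q(q-1)(q-5)+24k_4$; (d) $|\widetilde{C_4}(G)|=2|C_4(G)|=2|\overline{C_4}(G)|=\frac1{16}q(q-1)(q-5)+6k_4$; (e) $|\widetilde{K_{1,3}}(G)|=2|K_{1,3}(G)|=2|\overline{K_{1,3}}(G)|=\frac1{96}q(q-1)(q-5)(q-9)-8k_4$; (f) $|\widetilde{P_4}(G)|=|P_4(G)|=\frac1{64}q(q-1)(q^2-10q+41)-12k_4$.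
   Context: Let $p,q,r$ be positive integers with $p$ prime, $q=p^r$ and $q\equiv 1 \pmod 4$. The graph $G$ is fixed as follows. If $r$ is odd or $p\not\equiv 3\pmod 4$, $G$ is the $q$-vertex Paley graph. If $r$ is even and $p\equiv 3\pmod 4$, $G$ is either the $q$-vertex Paley graph or the $q$-vertex Peisert graph (the result holds for either choice). The $q$-vertex Paley graph has vertex set $\mathrm{GF}(q)$ and edges all $\{x,y\}$ with $x\ne y$ and $x-y$ a quadratic residue (nonzero square) in $\mathrm{GF}(q)$. The $q$-vertex Peisert graph (for $p\equiv 3\pmod 4$, $r$ even) has vertex set $\mathrm{GF}(q)$ and edges all $\{x,y\}$ such that $x-y=\omega^j$ for some $j$ with $j\equiv 0$ or $1\pmod 4$, where $\omega$ is a fixed primitive root (generator of the multiplicative group) of $\mathrm{GF}(q)$. $V$ denotes the vertex set of $G$. All graphs are finite and simple. $G[X]$ is the subgraph of $G$ induced by $X\subseteq V$. For a graph $H$, $\overline{H}$ is its complement, $H(G):=\{X\subseteq V: G[X]\cong H\}$, and $\widetilde{H}(G):=H(G)\cup\overline{H}(G)$. $K_t$ is the complete graph on $t$ vertices, $P_t$ the path on $t$ vertices, $C_t$ the cycle on $t$ vertices, $K_{s,t}$ the complete bipartite graph with parts of sizes $s,t$; $D$ (diamond) is $K_4$ minus one edge; $R$ (paw) is the graph obtained from $K_4$ by removing two edges which is not $C_4$ (i.e. a triangle with one pendant edge). *)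

theory Defs
  imports "HOL-Number_Theory.Number_Theory" "HOL-Library.Cardinality"
begin

text \<open>Finite simple graphs: a vertex set together with a set of two-element sets of vertices.\<close>

record 'a sgraph =
  verts :: "'a set"
  edges :: "'a set set"

definition induced_subgraph :: "'a sgraph \<Rightarrow> 'a set \<Rightarrow> 'a sgraph" where
  "induced_subgraph G X = \<lparr>verts = X, edges = {e \<in> edges G. e \<subseteq> X}\<rparr>"

definition complement :: "'a sgraph \<Rightarrow> 'a sgraph" where
  "complement G = \<lparr>verts = verts G,
     edges = {{x, y} | x y. x \<in> verts G \<and> y \<in> verts G \<and> x \<noteq> y \<and> {x, y} \<notin> edges G}\<rparr>"

definition graph_iso :: "'a sgraph \<Rightarrow> 'b sgraph \<Rightarrow> bool" where
  "graph_iso G H \<longleftrightarrow> (\<exists>f. bij_betw f (verts G) (verts H) \<and>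
     (\<forall>x\<in>verts G. \<forall>y\<in>verts G. {x, y} \<in> edges G \<longleftrightarrow> {f x, f y} \<in> edges H))"

text \<open>\<open>copies H G\<close> is \<open>H(G)\<close>, and \<open>sym_copies H G\<close> is \<open>H(G)\<close> together with the
  copies in \<open>G\<close> of the complement of \<open>H\<close>.\<close>

definition copies :: "'b sgraph \<Rightarrow> 'a sgraph \<Rightarrow> 'a set set" where
  "copies H G = {X. X \<subseteq> verts G \<and> graph_iso (induced_subgraph G X) H}"

definition sym_copies :: "'b sgraph \<Rightarrow> 'a sgraph \<Rightarrow> 'a set set" where
  "sym_copies H G = copies H G \<union> copies (complement H) G"

definition complete_graph :: "nat \<Rightarrow> nat sgraph" where
  "complete_graph t = \<lparr>verts = {..<t}, edges = {{i, j} | i j. i < t \<and> j < t \<and> i \<noteq> j}\<rparr>"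

definition path_graph :: "nat \<Rightarrow> nat sgraph" where
  "path_graph t = \<lparr>verts = {..<t}, edges = {{i, i + 1} | i. i + 1 < t}\<rparr>"

text \<open>A simple graph (the cycle on \<open>t\<close> vertices) only for \<open>t \<ge> 3\<close>.\<close>

definition cycle_graph :: "nat \<Rightarrow> nat sgraph" where
  "cycle_graph t = \<lparr>verts = {..<t}, edges = {{i, (i + 1) mod t} | i. i < t}\<rparr>"

definition complete_bipartite_graph :: "nat \<Rightarrow> nat \<Rightarrow> nat sgraph" where
  "complete_bipartite_graph s t =
     \<lparr>verts = {..<s + t}, edges = {{i, j} | i j. i < s \<and> s \<le> j \<and> j < s + t}\<rparr>"

definition diamond_graph :: "nat sgraph" where
  "diamond_graph = \<lparr>verts = verts (complete_graph 4),
     edges = edges (complete_graph 4) - {{0, 1}}\<rparr>"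

text \<open>The two removed edges share the vertex 0; removing two disjoint edges would give the
  4-cycle.\<close>

definition paw_graph :: "nat sgraph" where
  "paw_graph = \<lparr>verts = verts (complete_graph 4),
     edges = edges (complete_graph 4) - {{0, 1}, {0, 2}}\<rparr>"

definition quadratic_residue :: "'a::field \<Rightarrow> bool" where
  "quadratic_residue a \<longleftrightarrow> a \<noteq> 0 \<and> (\<exists>z. a = z ^ 2)"

definition primitive_root :: "'a::field \<Rightarrow> bool" where
  "primitive_root w \<longleftrightarrow> range (\<lambda>n::nat. w ^ n) = UNIV - {0}"

text \<open>In both graphs the condition on \<open>x - y\<close> is invariant under negation in the
  situations where the graph is considered (\<open>q \<equiv> 1 (mod 4)\<close>, respectively \<open>q = p ^ r\<close> with
  \<open>p \<equiv> 3 (mod 4)\<close> and \<open>r\<close> even, so that \<open>8\<close> divides \<open>q - 1\<close>).\<close>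

definition paley_graph :: "'a::field sgraph" where
  "paley_graph = \<lparr>verts = UNIV, edges = {{x, y} | x y. x \<noteq> y \<and> quadratic_residue (x - y)}\<rparr>"

definition peisert_graph :: "'a::field \<Rightarrow> 'a sgraph" where
  "peisert_graph w = \<lparr>verts = UNIV,
     edges = {{x, y} | x y. x \<noteq> y \<and>
       (\<exists>j::nat. ([j = 0] (mod 4) \<or> [j = 1] (mod 4)) \<and> x - y = w ^ j)}\<rparr>"

end

theory Submission
  imports Defs "HOL-Algebra.Algebraic_Closure_Type"
begin

text \<open>
  Both graphs are self-complementary and arc-transitive, and this determines their parameters.
  Write \<open>q = 4 * l + 5\<close>. Translations make the degree constant, and
  self-complementarity makes it \<open>(q - 1) div 2 = 2 * l + 2\<close>; arc-transitivity makes the number of common neighbours of two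
  adjacent vertices a constant; a complementing permutation carries the common non-neighbours of two
  non-adjacent vertices to the common neighbours of two adjacent ones; and counting walks of
  length two then fixes the constants as \<open>l\<close> for adjacent and \<open>l + 1\<close> for non-adjacent pairs
  (\<open>arc_transitive_self_complementary_imp_conference_graph\<close>). Graphs with these parameters are the
  conference graphs of the locale below.

  In a conference graph fix an ordered pair \<open>(u, v)\<close>, adjacent or not, and let two further vertices
  range over prescribed neighbourhood classes of \<open>u\<close> and \<open>v\<close>. The parameters determine the number
  of such quadruples, and the only freedom left is whether the two further vertices are adjacent.
  Hence each such count is the sum of the numbers of ordered induced copies of two graphs
  that differ in a single edge:
    \<^item> complete graph and diamond (\<open>complete_diamond_equation\<close>),
    \<^item> diamond and 4-cycle (\<open>diamond_cycle_equation\<close>),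
    \<^item> diamond and paw (\<open>diamond_paw_equation\<close>),
    \<^item> paw and claw (\<open>paw_claw_equation\<close>),
    \<^item> 4-cycle and path (\<open>cycle_path_equation\<close>).

  By \<open>card_embeddings\<close> the number of ordered induced copies of \<open>H\<close> is the number of copies
  times the number of automorphisms of \<open>H\<close>, so these are five linear equations in six unknowns, which
  leave only \<open>k4\<close> free and give the stated formulas
  (\<open>conference_graph_four_vertex_counts\<close>). Since \<open>G\<close> is isomorphic to its complement, \<open>H\<close> and its
  complement have equally many copies in \<open>G\<close>, and the two families of copies are disjoint unless \<open>H\<close>
  is self-complementary. On four vertices only the path is.

  For the symmetry of the two graphs let \<open>w\<close> be a primitive root. The connection set is
  \<open>{w ^ j | j. j mod 4 \<in> T}\<close> with \<open>T = {0, 2}\<close> for the Paley graph and \<open>T = {0, 1}\<close> for the Peisert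
  graph. Multiplication by \<open>w\<close> or by \<open>w ^ 2\<close>, respectively, exchanges edges and non-edges.
  Up to translations, multiplication by squares moves any edge of the Paley graph to any other one;
  in the Peisert graph fourth powers achieve this only within the classes \<open>0\<close> and \<open>1\<close>, and the maps
  \<open>x \<mapsto> w ^ k * x ^ p\<close> with \<open>k mod 4 = 1\<close> exchange the two classes because \<open>p mod 4 = 3\<close>
  (\<open>twisted_dilation\<close>).
\<close>

text \<open>Frees the unqualified name for primality in the type-class sense.\<close>

hide_const (open) Divisibility.prime

section \<open>Isomorphic graphs, complements and copies\<close>

lemma graph_iso_sym:
  assumes "graph_iso G H"
  shows "graph_iso H G"
proof -
  from assms obtain f where f: "bij_betw f (verts G) (verts H)"
    and e: "\<And>x y. x \<in> verts G \<Longrightarrow> y \<in> verts G \<Longrightarrow> {x, y} \<in> edges G \<longleftrightarrow> {f x, f y} \<in> edges H"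
    unfolding graph_iso_def by auto
  let ?g = "inv_into (verts G) f"
  have g: "bij_betw ?g (verts H) (verts G)" by (rule bij_betw_inv_into[OF f])
  have "{x, y} \<in> edges H \<longleftrightarrow> {?g x, ?g y} \<in> edges G" if "x \<in> verts H" "y \<in> verts H" for x y
    using e[of "?g x" "?g y"] that bij_betw_apply[OF g] bij_betw_inv_into_right[OF f] by auto
  then show ?thesis unfolding graph_iso_def using g by blast
qed

lemma graph_iso_trans:
  assumes "graph_iso G H" "graph_iso H K"
  shows "graph_iso G K"
proof -
  from assms(1) obtain f where f: "bij_betw f (verts G) (verts H)"
    and e: "\<And>x y. x \<in> verts G \<Longrightarrow> y \<in> verts G \<Longrightarrow> {x, y} \<in> edges G \<longleftrightarrow> {f x, f y} \<in> edges H"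
    unfolding graph_iso_def by auto
  from assms(2) obtain g where g: "bij_betw g (verts H) (verts K)"
    and e': "\<And>x y. x \<in> verts H \<Longrightarrow> y \<in> verts H \<Longrightarrow> {x, y} \<in> edges H \<longleftrightarrow> {g x, g y} \<in> edges K"
    unfolding graph_iso_def by auto
  show ?thesis unfolding graph_iso_def
  proof (intro exI[of _ "g \<circ> f"] conjI ballI)
    show "bij_betw (g \<circ> f) (verts G) (verts K)" by (rule bij_betw_trans[OF f g])
    fix x y assume "x \<in> verts G" "y \<in> verts G"
    then show "({x, y} \<in> edges G) = ({(g \<circ> f) x, (g \<circ> f) y} \<in> edges K)"
      using e e' bij_betw_apply[OF f] by simp
  qed
qed

lemma copies_cong_iso:
  assumes "graph_iso H K"
  shows "copies H G = copies K G"
proof -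
  have "graph_iso K' H \<longleftrightarrow> graph_iso K' K" for K' :: "'c sgraph"
    using graph_iso_trans[OF _ assms] graph_iso_trans[OF _ graph_iso_sym[OF assms]] by (intro iffI)
  then show ?thesis by (simp add: copies_def)
qed

lemma card_copies_cong_iso:
  assumes "graph_iso G K"
  shows "card (copies H G) = card (copies H K)"
proof -
  from assms obtain f where f: "bij_betw f (verts G) (verts K)"
    and e: "\<And>x y. x \<in> verts G \<Longrightarrow> y \<in> verts G \<Longrightarrow> {x, y} \<in> edges G \<longleftrightarrow> {f x, f y} \<in> edges K"
    unfolding graph_iso_def by auto
  have iso: "graph_iso (induced_subgraph G A) (induced_subgraph K (f ` A))" if A: "A \<subseteq> verts G" for A
  proof -
    have "bij_betw f A (f ` A)" using f A by (auto simp: bij_betw_def intro: inj_on_subset)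
    moreover have "{x, y} \<in> edges G \<longleftrightarrow> {f x, f y} \<in> edges K" if "x \<in> A" "y \<in> A" for x y
      using e[of x y] that A by blast
    ultimately show ?thesis
      unfolding graph_iso_def induced_subgraph_def by (intro exI[of _ f]) auto
  qed
  have pow: "bij_betw ((`) f) (Pow (verts G)) (Pow (verts K))"
    by (rule bij_betw_Pow[OF f])
  have iff: "f ` A \<in> copies H K \<longleftrightarrow> A \<in> copies H G" if A: "A \<subseteq> verts G" for A
  proof -
    have "graph_iso (induced_subgraph K (f ` A)) H \<longleftrightarrow> graph_iso (induced_subgraph G A) H"
      using graph_iso_trans[OF iso[OF A]] graph_iso_trans[OF graph_iso_sym[OF iso[OF A]]]
      by (intro iffI)
    moreover have "f ` A \<subseteq> verts K" using A f by (auto simp: bij_betw_def)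
    ultimately show ?thesis using A by (simp add: copies_def)
  qed
  have "(`) f ` copies H G = copies H K"
  proof (intro equalityI subsetI)
    fix Y assume "Y \<in> (`) f ` copies H G"
    then obtain A where "A \<in> copies H G" "Y = f ` A" by blast
    moreover from this have "A \<subseteq> verts G" by (simp add: copies_def)
    ultimately show "Y \<in> copies H K" using iff by simp
  next
    fix Y assume Y: "Y \<in> copies H K"
    then have "Y \<in> (`) f ` Pow (verts G)"
      using pow by (simp add: bij_betw_def copies_def)
    then show "Y \<in> (`) f ` copies H G" using Y iff by blast
  qed
  moreover have "copies H G \<subseteq> Pow (verts G)" by (auto simp: copies_def)
  ultimately have "bij_betw ((`) f) (copies H G) (copies H K)"
    by (intro bij_betw_subset[OF pow])
  then show ?thesis by (rule bij_betw_same_card)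
qed

lemma verts_complement [simp]: "verts (complement G) = verts G"
  by (simp add: complement_def)

lemma edge_complement_iff:
  "{x, y} \<in> edges (complement G) \<longleftrightarrow> x \<in> verts G \<and> y \<in> verts G \<and> x \<noteq> y \<and> {x, y} \<notin> edges G"
  by (auto simp: complement_def doubleton_eq_iff insert_commute)

lemma complement_loopless: "{x} \<notin> edges (complement G)"
  using edge_complement_iff[of x x G] by simp

lemma copies_complement:
  assumes G: "\<And>x. {x} \<notin> edges G" and H: "\<And>x. {x} \<notin> edges H"
  shows "copies (complement H) (complement G) = copies H G"
proof -
  have "graph_iso (induced_subgraph (complement G) A) (complement H)
      \<longleftrightarrow> graph_iso (induced_subgraph G A) H" if A: "A \<subseteq> verts G" for A
  proof -
    have "({x, y} \<in> edges (complement G) \<longleftrightarrow> {f x, f y} \<in> edges (complement H))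
        \<longleftrightarrow> ({x, y} \<in> edges G \<longleftrightarrow> {f x, f y} \<in> edges H)"
      if f: "bij_betw f A (verts H)" and xy: "x \<in> A" "y \<in> A" for f x y
    proof (cases "x = y")
      case True
      then show ?thesis using G H by (simp add: complement_loopless)
    next
      case False
      then have "f x \<noteq> f y" using f xy by (auto simp: bij_betw_def dest: inj_onD)
      moreover have "x \<in> verts G" "y \<in> verts G" using xy A by auto
      ultimately show ?thesis
        using False xy bij_betw_apply[OF f] by (simp add: edge_complement_iff)
    qed
    then show ?thesis
      unfolding graph_iso_def induced_subgraph_def
      by (intro ex_cong1 conj_cong refl) auto
  qed
  then show ?thesis by (auto simp: copies_def)
qed

text \<open>
  The ordered induced copies of \<open>H\<close> in \<open>G\<close>. Restricting to extensional functions makes equality of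
  embeddings the same as equality on the vertices of \<open>H\<close>, so that counting them is meaningful; for
  finite \<open>H\<close>, \<open>embeddings H H\<close> is the automorphism group.
\<close>

definition embeddings :: "'b sgraph \<Rightarrow> 'a sgraph \<Rightarrow> ('b \<Rightarrow> 'a) set" where
  "embeddings H G = {f \<in> verts H \<rightarrow>\<^sub>E verts G. inj_on f (verts H) \<and>
     (\<forall>x\<in>verts H. \<forall>y\<in>verts H. {f x, f y} \<in> edges G \<longleftrightarrow> {x, y} \<in> edges H)}"

lemma finite_embeddings:
  assumes "finite (verts H)" "finite (verts G)"
  shows "finite (embeddings H G)"
  by (rule finite_subset[OF _ finite_PiE[OF assms(1), of "\<lambda>_. verts G"]])
     (auto simp: embeddings_def assms)

lemma image_embedding_in_copies:
  assumes "f \<in> embeddings H G"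
  shows "f ` verts H \<in> copies H G"
proof -
  have "graph_iso H (induced_subgraph G (f ` verts H))"
    using assms unfolding graph_iso_def embeddings_def induced_subgraph_def
    by (intro exI[of _ f]) (auto simp: bij_betw_def)
  then show ?thesis using assms graph_iso_sym by (auto simp: copies_def embeddings_def)
qed

text \<open>
  The embeddings with a given image form a torsor under the automorphisms of \<open>H\<close>: fix one
  of them, \<open>h\<close>; then every other one is \<open>h\<close> composed with a unique automorphism.
\<close>

lemma card_embeddings_onto:
  assumes fin: "finite (verts H)" and A: "A \<in> copies H G"
  shows "card {f \<in> embeddings H G. f ` verts H = A} = card (embeddings H H)"
proof -
  from A have XG: "A \<subseteq> verts G" and "graph_iso H (induced_subgraph G A)"
    using graph_iso_sym by (auto simp: copies_def)
  then obtain h where h: "bij_betw h (verts H) A"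
    and "\<And>x y. x \<in> verts H \<Longrightarrow> y \<in> verts H \<Longrightarrow>
      {x, y} \<in> edges H \<longleftrightarrow> {h x, h y} \<in> edges (induced_subgraph G A)"
    unfolding graph_iso_def by (auto simp: induced_subgraph_def)
  then have e: "{h x, h y} \<in> edges G \<longleftrightarrow> {x, y} \<in> edges H"
    if "x \<in> verts H" "y \<in> verts H" for x y
    using that bij_betw_apply[OF h] by (auto simp: induced_subgraph_def)
  let ?h' = "inv_into (verts H) h"
  have h': "bij_betw ?h' A (verts H)" by (rule bij_betw_inv_into[OF h])
  have hh': "h (?h' x) = x" if "x \<in> A" for x
    using that bij_betw_inv_into_right[OF h] by simp
  have h'h: "?h' (h x) = x" if "x \<in> verts H" for x
    using that bij_betw_inv_into_left[OF h] by simp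
  have "bij_betw (compose (verts H) h) (embeddings H H) {f \<in> embeddings H G. f ` verts H = A}"
  proof (rule bij_betw_byWitness[where f' = "compose (verts H) ?h'"])
    show "\<forall>s\<in>embeddings H H. compose (verts H) ?h' (compose (verts H) h s) = s"
      by (auto simp: embeddings_def compose_def fun_eq_iff h'h PiE_iff extensional_def)
    show "\<forall>f\<in>{f \<in> embeddings H G. f ` verts H = A}. compose (verts H) h (compose (verts H) ?h' f) = f"
      by (auto simp: embeddings_def compose_def fun_eq_iff hh' PiE_iff extensional_def)
    show "compose (verts H) h ` embeddings H H \<subseteq> {f \<in> embeddings H G. f ` verts H = A}"
    proof clarify
      fix s assume s: "s \<in> embeddings H H"
      then have im: "s ` verts H = verts H"
        using endo_inj_surj[OF fin] by (auto simp: embeddings_def)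
      have "bij_betw s (verts H) (verts H)" using s im by (auto simp: bij_betw_def embeddings_def)
      then have b: "bij_betw (h \<circ> s) (verts H) A" using h by (rule bij_betw_trans)
      then have b': "bij_betw (compose (verts H) h s) (verts H) A"
        by (rule bij_betw_cong[THEN iffD1, rotated]) (simp add: compose_def)
      moreover have "compose (verts H) h s \<in> embeddings H G"
        using s b' XG e bij_betw_apply[OF h] by (auto simp: embeddings_def compose_def bij_betw_def PiE_iff)
      ultimately show "compose (verts H) h s \<in> embeddings H G \<and> compose (verts H) h s ` verts H = A"
        by (auto simp: bij_betw_def)
    qed
    show "compose (verts H) ?h' ` {f \<in> embeddings H G. f ` verts H = A} \<subseteq> embeddings H H"
    proof clarify
      fix f assume f: "f \<in> embeddings H G" "A = f ` verts H"
      then have fX: "f x \<in> A" if "x \<in> verts H" for x using that by auto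
      have "bij_betw f (verts H) A" using f by (auto simp: bij_betw_def embeddings_def)
      then have "bij_betw (?h' \<circ> f) (verts H) (verts H)" using h' by (rule bij_betw_trans)
      then have b': "bij_betw (compose (verts H) ?h' f) (verts H) (verts H)"
        by (rule bij_betw_cong[THEN iffD1, rotated]) (simp add: compose_def)
      have "{?h' (f x), ?h' (f y)} \<in> edges H \<longleftrightarrow> {x, y} \<in> edges H"
        if "x \<in> verts H" "y \<in> verts H" for x y
        using e[of "?h' (f x)" "?h' (f y)"] f that fX bij_betw_apply[OF h'] hh'
        by (auto simp: embeddings_def)
      then show "compose (verts H) (inv_into (verts H) h) f \<in> embeddings H H"
        using b' by (auto simp: embeddings_def compose_def bij_betw_def PiE_iff)
    qed
  qed
  then show ?thesis by (rule bij_betw_same_card[symmetric])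
qed

lemma card_embeddings:
  assumes "finite (verts H)" "finite (verts G)"
  shows "card (embeddings H G) = card (embeddings H H) * card (copies H G)"
proof -
  have fin: "finite (copies H G)"
    by (rule finite_subset[of _ "Pow (verts G)"]) (auto simp: copies_def assms)
  have "embeddings H G = (\<Union>A\<in>copies H G. {f \<in> embeddings H G. f ` verts H = A})"
    using image_embedding_in_copies by blast
  then have "card (embeddings H G) = card (\<Union>A\<in>copies H G. {f \<in> embeddings H G. f ` verts H = A})"
    by simp
  also have "\<dots> = (\<Sum>A\<in>copies H G. card {f \<in> embeddings H G. f ` verts H = A})"
    using fin finite_embeddings[OF assms] by (intro card_UN_disjoint) auto
  also have "\<dots> = (\<Sum>A\<in>copies H G. card (embeddings H H))"
    by (intro sum.cong refl card_embeddings_onto assms)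
  finally show ?thesis by simp
qed

text \<open>
  Every edge contributes two arcs. Ordered pairs are easier to transport along isomorphisms and to
  enumerate than two-element sets.
\<close>

definition arcs :: "'a sgraph \<Rightarrow> ('a \<times> 'a) set" where
  "arcs G = {(x, y). x \<in> verts G \<and> y \<in> verts G \<and> {x, y} \<in> edges G}"

lemma card_arcs_cong_iso:
  assumes "graph_iso G H"
  shows "card (arcs G) = card (arcs H)"
proof -
  from assms obtain f where f: "bij_betw f (verts G) (verts H)"
    and e: "\<And>x y. x \<in> verts G \<Longrightarrow> y \<in> verts G \<Longrightarrow> {x, y} \<in> edges G \<longleftrightarrow> {f x, f y} \<in> edges H"
    unfolding graph_iso_def by auto
  have "bij_betw (map_prod f f) (verts G \<times> verts G) (verts H \<times> verts H)"
    using f by (rule bij_betw_map_prod[OF _ f])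
  then have "bij_betw (map_prod f f) (arcs G) (arcs H)"
  proof (rule bij_betw_subset)
    show "arcs G \<subseteq> verts G \<times> verts G" by (auto simp: arcs_def)
    have "p \<in> map_prod f f ` arcs G" if p: "p \<in> arcs H" for p
    proof -
      obtain u v where p': "p = (u, v)" "u \<in> verts H" "v \<in> verts H" "{u, v} \<in> edges H"
        using p by (auto simp: arcs_def)
      moreover have "verts H = f ` verts G" using f by (simp add: bij_betw_def)
      ultimately obtain x y where "x \<in> verts G" "y \<in> verts G" "u = f x" "v = f y" by auto
      then show ?thesis using p' e by (auto simp: arcs_def intro!: image_eqI[of _ _ "(x, y)"])
    qed
    then show "map_prod f f ` arcs G = arcs H"
      using bij_betw_apply[OF f] e by (auto simp: arcs_def)
  qed
  then show ?thesis by (rule bij_betw_same_card)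
qed

text \<open>
  A copy of the complement of \<open>H\<close> in \<open>G\<close> is a copy of \<open>H\<close> in the complement of \<open>G\<close>, and \<open>G\<close> is
  isomorphic to that complement.
\<close>

lemma card_copies_complement:
  assumes "graph_iso G (complement G)" "\<And>x. {x} \<notin> edges G" "\<And>x. {x} \<notin> edges H"
  shows "card (copies (complement H) G) = card (copies H G)"
proof -
  have "card (copies (complement H) G) = card (copies (complement H) (complement G))"
    by (rule card_copies_cong_iso[OF assms(1)])
  also have "copies (complement H) (complement G) = copies H G"
    using assms(2,3) by (rule copies_complement)
  finally show ?thesis .
qed

lemma card_ordered_pairs:
  assumes "finite A"
  shows "card {(x, y). x \<in> A \<and> y \<in> A \<and> x \<noteq> y} = card A * (card A - 1)"
proof -
  have "{(x, y). x \<in> A \<and> y \<in> A \<and> x \<noteq> y} = (SIGMA x:A. A - {x})" by auto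
  then show ?thesis using assms by simp
qed

lemma card_arcs_complement:
  assumes "finite (verts H)" and H: "\<And>x. {x} \<notin> edges H"
  shows "card (arcs H) + card (arcs (complement H)) = card (verts H) * (card (verts H) - 1)"
proof -
  have fin: "finite (arcs K)" if "finite (verts K)" for K :: "'a sgraph"
    using that by (intro finite_subset[of "arcs K" "verts K \<times> verts K"]) (auto simp: arcs_def)
  have "arcs H \<inter> arcs (complement H) = {}" by (auto simp: arcs_def edge_complement_iff)
  then have "card (arcs H) + card (arcs (complement H)) = card (arcs H \<union> arcs (complement H))"
    using fin assms(1) by (subst card_Un_disjoint) auto
  also have "arcs H \<union> arcs (complement H) = {(x, y). x \<in> verts H \<and> y \<in> verts H \<and> x \<noteq> y}"
    using H by (auto simp: arcs_def edge_complement_iff)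
  finally show ?thesis by (simp only: card_ordered_pairs[OF assms(1)])
qed

text \<open>A self-complementary graph has exactly half of all possible edges.\<close>

lemma not_self_complementary_if_card_arcs:
  assumes "finite (verts H)" "\<And>x. {x} \<notin> edges H"
    and "2 * card (arcs H) \<noteq> card (verts H) * (card (verts H) - 1)"
  shows "\<not> graph_iso H (complement H)"
  using card_arcs_cong_iso[of H "complement H"] card_arcs_complement[OF assms(1,2)] assms(3) by auto

lemma card_sym_copies:
  assumes fin: "finite (verts G)" and sc: "graph_iso G (complement G)"
    and G: "\<And>x. {x} \<notin> edges G" and H: "\<And>x. {x} \<notin> edges H"
    and not_sc: "\<not> graph_iso H (complement H)"
  shows "card (sym_copies H G) = 2 * card (copies H G)"
proof -
  have "copies H G \<inter> copies (complement H) G = {}"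
  proof (intro equals0I)
    fix A assume "A \<in> copies H G \<inter> copies (complement H) G"
    then have "graph_iso (induced_subgraph G A) H" "graph_iso (induced_subgraph G A) (complement H)"
      by (simp_all add: copies_def)
    then have "graph_iso H (complement H)"
      by (rule graph_iso_trans[OF graph_iso_sym])
    then show False using not_sc by contradiction
  qed
  moreover have "finite (copies K G)" for K :: "'b sgraph"
    by (rule finite_subset[of _ "Pow (verts G)"]) (auto simp: copies_def fin)
  ultimately have "card (sym_copies H G) = card (copies H G) + card (copies (complement H) G)"
    by (simp add: sym_copies_def card_Un_disjoint)
  then show ?thesis using card_copies_complement[OF sc G H] by simp
qed

section \<open>The graphs on four vertices\<close>

text \<open>
  Quadruples of vertices whose induced labelled graph is prescribed by six truth values, one for each
  pair of positions, \<open>eij\<close> for positions \<open>i\<close> and \<open>j\<close>. This is the concrete form of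
  \<open>embeddings\<close> for patterns with vertices \<open>0\<close>, \<open>1\<close>, \<open>2\<close>, \<open>3\<close>; patterns that differ
  in one edge differ in one argument.
\<close>

definition induced_quads ::
    "'a sgraph \<Rightarrow> bool \<Rightarrow> bool \<Rightarrow> bool \<Rightarrow> bool \<Rightarrow> bool \<Rightarrow> bool \<Rightarrow> ('a \<times> 'a \<times> 'a \<times> 'a) set" where
  "induced_quads G e01 e02 e03 e12 e13 e23 = {(a, b, c, d).
     {a, b, c, d} \<subseteq> verts G \<and> distinct [a, b, c, d] \<and>
     ({a, b} \<in> edges G \<longleftrightarrow> e01) \<and> ({a, c} \<in> edges G \<longleftrightarrow> e02) \<and> ({a, d} \<in> edges G \<longleftrightarrow> e03) \<and>
     ({b, c} \<in> edges G \<longleftrightarrow> e12) \<and> ({b, d} \<in> edges G \<longleftrightarrow> e13) \<and> ({c, d} \<in> edges G \<longleftrightarrow> e23)}"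

lemma card_embeddings_eq_card_quads:
  fixes H :: "nat sgraph" and G :: "'a sgraph"
  assumes V: "verts H = {..<4}"
    and H: "\<And>i. {i} \<notin> edges H" and G: "\<And>x. {x} \<notin> edges G"
  shows "card (embeddings H G) = card (induced_quads G ({0, 1} \<in> edges H) ({0, 2} \<in> edges H)
    ({0, 3} \<in> edges H) ({1, 2} \<in> edges H) ({1, 3} \<in> edges H) ({2, 3} \<in> edges H))"
    (is "_ = card ?Q")
proof -
  have four: "{..<4} = {0, 1, 2, 3::nat}" by auto
  let ?t = "\<lambda>f::nat \<Rightarrow> 'a. (f 0, f 1, f 2, f 3)"
  let ?u = "\<lambda>(a, b, c, d). \<lambda>i\<in>{..<4::nat}. [a, b, c, d] ! i"
  have "bij_betw ?t (embeddings H G) ?Q"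
  proof (rule bij_betw_byWitness[where f' = ?u])
    show "\<forall>f\<in>embeddings H G. ?u (?t f) = f"
      by (auto simp: embeddings_def V four PiE_iff extensional_def fun_eq_iff)
    show "\<forall>p\<in>?Q. ?t (?u p) = p"
      by auto
    show "?t ` embeddings H G \<subseteq> ?Q"
    proof clarify
      fix f assume f: "f \<in> embeddings H G"
      have "f i \<in> verts G" if "i < 4" for i using f that by (auto simp: embeddings_def V)
      moreover have "f i = f j \<longleftrightarrow> i = j" if "i < 4" "j < 4" for i j
        using f that by (auto simp: embeddings_def V dest: inj_onD)
      moreover have "{f i, f j} \<in> edges G \<longleftrightarrow> {i, j} \<in> edges H" if "i < 4" "j < 4" for i j
        using f that by (auto simp: embeddings_def V)
      ultimately show "(f 0, f 1, f 2, f 3) \<in> ?Q" by (simp add: induced_quads_def)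
    qed
    show "?u ` ?Q \<subseteq> embeddings H G"
    proof clarify
      fix a b c d assume q: "(a, b, c, d) \<in> ?Q"
      define f where "f = (\<lambda>i\<in>{..<4}. [a, b, c, d] ! i)"
      have f: "f 0 = a" "f 1 = b" "f (Suc 0) = b" "f 2 = c" "f 3 = d" by (simp_all add: f_def)
      have "f \<in> verts H \<rightarrow>\<^sub>E verts G"
        using q by (auto simp: f_def V four induced_quads_def)
      moreover have "inj_on f (verts H)"
        using q unfolding V four by (simp add: f induced_quads_def)
      moreover have "\<forall>i\<in>verts H. \<forall>j\<in>verts H. {f i, f j} \<in> edges G \<longleftrightarrow> {i, j} \<in> edges H"
        using q G H unfolding V four
        by (simp add: f induced_quads_def insert_commute)
      ultimately show "(\<lambda>i\<in>{..<4}. [a, b, c, d] ! i) \<in> embeddings H G"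
        by (simp add: embeddings_def f_def)
    qed
  qed
  then show ?thesis by (rule bij_betw_same_card)
qed

lemma edges_complete_graph_4:
  "edges (complete_graph 4) = {{0, 1}, {0, 2}, {0, 3}, {1, 2}, {1, 3}, {2, 3}}"
proof -
  have "edges (complete_graph 4) = (\<lambda>(i, j). {i, j}) ` {(i, j) \<in> {..<4} \<times> {..<4}. i \<noteq> j}"
    by (auto simp: complete_graph_def)
  also have "{(i, j) \<in> {..<4} \<times> {..<4}. i \<noteq> j} =
      set (filter (\<lambda>(i, j). i \<noteq> j) (List.product [0..<4] [0..<4::nat]))"
    by auto
  finally have "edges (complete_graph 4) = {{0, 1}, {0, Suc 1}, {0, Suc (Suc 1)},
      {1, Suc 1}, {1, Suc (Suc 1)}, {Suc 1, Suc (Suc 1)}}"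
    by (simp add: upt_rec insert_commute)
  then show ?thesis by (simp add: numeral_2_eq_2 numeral_3_eq_3)
qed

lemma edges_diamond_graph:
  "edges diamond_graph = {{0, 2}, {0, 3}, {1, 2}, {1, 3}, {2, 3}}"
  by (simp add: diamond_graph_def edges_complete_graph_4 insert_Diff_if doubleton_eq_iff)

lemma edges_paw_graph:
  "edges paw_graph = {{0, 3}, {1, 2}, {1, 3}, {2, 3}}"
  by (simp add: paw_graph_def edges_complete_graph_4 insert_Diff_if doubleton_eq_iff)

lemma edges_path_graph_4: "edges (path_graph 4) = {{0, 1}, {1, 2}, {2, 3}}"
proof -
  have "edges (path_graph 4) = (\<lambda>i. {i, i + 1}) ` {..<3}" by (auto simp: path_graph_def)
  also have "{..<3} = {0, 1, 2::nat}" by auto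
  finally show ?thesis by (simp add: numeral_eq_Suc)
qed

lemma edges_cycle_graph_4: "edges (cycle_graph 4) = {{0, 1}, {1, 2}, {2, 3}, {0, 3}}"
proof -
  have "edges (cycle_graph 4) = (\<lambda>i. {i, (i + 1) mod 4}) ` {..<4}" by (auto simp: cycle_graph_def)
  also have "{..<4} = {0, 1, 2, 3::nat}" by auto
  finally have "edges (cycle_graph 4) = {{0, 1}, {1, Suc 1}, {2, Suc 2}, {3, 0}}" by simp
  moreover have "Suc 1 = 2" "Suc 2 = 3" "{3, 0} = {0, 3::nat}" by auto
  ultimately show ?thesis by (simp add: numeral_2_eq_2 numeral_3_eq_3)
qed

lemma edges_claw_graph: "edges (complete_bipartite_graph 1 3) = {{0, 1}, {0, 2}, {0, 3}}"
proof -
  have "edges (complete_bipartite_graph 1 3) = (\<lambda>j. {0, j}) ` {1..<4}"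
    by (auto simp: complete_bipartite_graph_def)
  also have "{1..<4} = {1, 2, 3::nat}" by auto
  finally show ?thesis by simp
qed

lemma verts_patterns:
  "verts (complete_graph 4) = {..<4}" "verts diamond_graph = {..<4}" "verts paw_graph = {..<4}"
  "verts (cycle_graph 4) = {..<4}" "verts (complete_bipartite_graph 1 3) = {..<4}"
  "verts (path_graph 4) = {..<4}"
  by (simp_all add: complete_graph_def diamond_graph_def paw_graph_def cycle_graph_def
      complete_bipartite_graph_def path_graph_def)

lemmas edges_patterns = edges_complete_graph_4 edges_diamond_graph edges_paw_graph
  edges_cycle_graph_4 edges_claw_graph edges_path_graph_4

lemma patterns_loopless:
  "{i} \<notin> edges (complete_graph 4)" "{i} \<notin> edges diamond_graph" "{i} \<notin> edges paw_graph"
  "{i} \<notin> edges (cycle_graph 4)" "{i} \<notin> edges (complete_bipartite_graph 1 3)"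
  "{i} \<notin> edges (path_graph 4)"
  unfolding edges_patterns by auto

text \<open>Turns the count of automorphisms of a concrete pattern into an executable enumeration.\<close>

lemma card_induced_quads_eq_length_filter:
  assumes "verts H = {..<4}"
  shows "card (induced_quads H e01 e02 e03 e12 e13 e23) = length (filter (\<lambda>(a, b, c, d).
     distinct [a, b, c, d] \<and>
     ({a, b} \<in> edges H \<longleftrightarrow> e01) \<and> ({a, c} \<in> edges H \<longleftrightarrow> e02) \<and> ({a, d} \<in> edges H \<longleftrightarrow> e03) \<and>
     ({b, c} \<in> edges H \<longleftrightarrow> e12) \<and> ({b, d} \<in> edges H \<longleftrightarrow> e13) \<and> ({c, d} \<in> edges H \<longleftrightarrow> e23))
     (List.product [0..<4] (List.product [0..<4] (List.product [0..<4] [0..<4]))))"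
    (is "_ = length (filter ?P ?L)")
proof -
  have "induced_quads H e01 e02 e03 e12 e13 e23 = set (filter ?P ?L)"
    by (simp add: set_eq_iff induced_quads_def assms)
  then have "card (induced_quads H e01 e02 e03 e12 e13 e23) = card (set (filter ?P ?L))" by simp
  also have "\<dots> = length (filter ?P ?L)"
    by (rule distinct_card) (intro distinct_filter distinct_product distinct_upt)
  finally show ?thesis .
qed

lemma card_embeddings_self:
  "card (embeddings (complete_graph 4) (complete_graph 4)) = 24"
  "card (embeddings diamond_graph diamond_graph) = 4"
  "card (embeddings paw_graph paw_graph) = 2"
  "card (embeddings (cycle_graph 4) (cycle_graph 4)) = 8"
  "card (embeddings (complete_bipartite_graph 1 3) (complete_bipartite_graph 1 3)) = 6"
  "card (embeddings (path_graph 4) (path_graph 4)) = 2"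
  apply (simp_all only: card_embeddings_eq_card_quads card_induced_quads_eq_length_filter verts_patterns
     patterns_loopless not_False_eq_True)
  unfolding edges_patterns
  by code_simp+

lemma path_graph_4_self_complementary: "graph_iso (path_graph 4) (complement (path_graph 4))"
proof -
  have four: "{..<4} = {0, 1, 2, 3::nat}" by auto
  let ?f = "\<lambda>i::nat. if i = 0 then 2 else if i = 1 then 0 else if i = 2 then 3 else 1 :: nat"
  have "bij_betw ?f {0, 1, 2, 3} {0, 1, 2, 3}" by (auto simp: bij_betw_def)
  moreover have "\<forall>i\<in>{0, 1, 2, 3}. \<forall>j\<in>{0, 1, 2, 3}.
    {i, j} \<in> edges (path_graph 4) \<longleftrightarrow> {?f i, ?f j} \<in> edges (complement (path_graph 4))"
    unfolding edge_complement_iff edges_path_graph_4 verts_patterns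
    by code_simp
  ultimately show ?thesis
    unfolding graph_iso_def verts_complement verts_patterns four by blast
qed

lemma card_arcs_eq_length_filter:
  assumes "verts H = {..<4}"
  shows "card (arcs H) = length (filter (\<lambda>(i, j). {i, j} \<in> edges H) (List.product [0..<4] [0..<4]))"
    (is "_ = length (filter ?P ?L)")
proof -
  have "arcs H = set (filter ?P ?L)" by (auto simp: arcs_def assms)
  then have "card (arcs H) = card (set (filter ?P ?L))" by simp
  also have "\<dots> = length (filter ?P ?L)"
    by (rule distinct_card) (intro distinct_filter distinct_product distinct_upt)
  finally show ?thesis .
qed

lemma card_arcs_patterns:
  "card (arcs (complete_graph 4)) = 12" "card (arcs diamond_graph) = 10" "card (arcs paw_graph) = 8"
  "card (arcs (cycle_graph 4)) = 8"
  apply (simp_all only: card_arcs_eq_length_filter verts_patterns)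
  unfolding edges_patterns
  by code_simp+

text \<open>
  The claw and its complement both have three edges, so counting edges does not separate them. But the
  vertex \<open>0\<close> is isolated in the complement, while the claw has no isolated vertex.
\<close>

lemma claw_not_self_complementary:
  "\<not> graph_iso (complete_bipartite_graph 1 3) (complement (complete_bipartite_graph 1 3))"
    (is "\<not> graph_iso ?H _")
proof
  assume "graph_iso ?H (complement ?H)"
  then obtain f where f: "bij_betw f {..<4} {..<4}"
    and e: "\<And>x y. x < 4 \<Longrightarrow> y < 4 \<Longrightarrow> {x, y} \<in> edges ?H \<Longrightarrow> {f x, f y} \<in> edges (complement ?H)"
    unfolding graph_iso_def verts_complement verts_patterns by auto
  have "0 \<in> f ` {..<4}" using f by (simp add: bij_betw_def)
  then obtain x where x: "x < 4" "f x = 0" by auto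
  define y where "y = (if x = 0 then 1 else 0 :: nat)"
  have "{x, y} \<in> edges ?H"
  proof -
    consider "x = 0" | "x = 1" | "x = 2" | "x = 3" using x(1) by linarith
    then show ?thesis unfolding edges_claw_graph y_def by cases (simp_all add: doubleton_eq_iff)
  qed
  then have "{0, f y} \<in> edges (complement ?H)" using e[of x y] x by (simp add: y_def)
  then have "f y < 4" "f y \<noteq> 0" "{0, f y} \<notin> edges ?H"
    unfolding edge_complement_iff verts_patterns by simp_all
  moreover from this have "f y = 1 \<or> f y = 2 \<or> f y = 3" by linarith
  ultimately show False unfolding edges_claw_graph by auto
qed

section \<open>Counting four-vertex subgraphs of a conference graph\<close>

text \<open>
  Strongly regular graphs with the parameters
  \<open>(q, (q - 1) div 2, (q - 5) div 4, (q - 1) div 4)\<close>. The parameter \<open>l\<close>, the number of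
  common neighbours of adjacent vertices, is used instead of \<open>q\<close> to avoid truncated subtraction and
  division.
\<close>

locale conference_graph =
  fixes G :: "'a::finite sgraph" and l :: nat
  assumes verts_UNIV: "verts G = UNIV"
    and loopless: "{x} \<notin> edges G"
    and order: "CARD('a) = 4 * l + 5"
    and degree: "card {z. {x, z} \<in> edges G} = 2 * l + 2"
    and adjacent_common: "{x, y} \<in> edges G \<Longrightarrow> card {z. {x, z} \<in> edges G \<and> {y, z} \<in> edges G} = l"
    and nonadjacent_common: "x \<noteq> y \<Longrightarrow> {x, y} \<notin> edges G \<Longrightarrow>
      card {z. {x, z} \<in> edges G \<and> {y, z} \<in> edges G} = l + 1"

lemma card_quadruples:
  fixes P :: "'a::finite \<Rightarrow> 'a \<Rightarrow> bool" and Q :: "'a \<Rightarrow> 'a \<Rightarrow> 'a \<Rightarrow> 'a \<Rightarrow> bool"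
  assumes "\<And>x y. P x y \<Longrightarrow> card {(z, w). Q x y z w} = n"
  shows "card {(x, y, z, w). P x y \<and> Q x y z w} = card {(x, y). P x y} * n"
proof -
  let ?S = "SIGMA p:{(x, y). P x y}. {(z, w). Q (fst p) (snd p) z w}"
  have "bij_betw (\<lambda>((x, y), z, w). (x, y, z, w)) ?S {(x, y, z, w). P x y \<and> Q x y z w}"
    by (rule bij_betw_byWitness[where f' = "\<lambda>(x, y, z, w). ((x, y), z, w)"]) auto
  then have "card {(x, y, z, w). P x y \<and> Q x y z w} = card ?S"
    by (rule bij_betw_same_card[symmetric])
  also have "\<dots> = (\<Sum>p\<in>{(x, y). P x y}. card {(z, w). Q (fst p) (snd p) z w})"
    by (rule card_SigmaI) auto
  also have "\<dots> = (\<Sum>p\<in>{(x, y). P x y}. n)"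
    using assms by (intro sum.cong refl) (simp split: prod.splits)
  finally show ?thesis by simp
qed

text \<open>
  The coordinate permutations that the equations below need: the first four bring the two base vertices
  to the front, the last one relabels the 4-cycle. The second one also serves to relabel the claw.
\<close>

lemma card_quadruples_reorder:
  "card {(c, d, a, b). R a b c d} = card {(a, b, c, d). R a b c d}"
  "card {(d, b, c, a). R a b c d} = card {(a, b, c, d). R a b c d}"
  "card {(d, a, b, c). R a b c d} = card {(a, b, c, d). R a b c d}"
  "card {(b, c, a, d). R a b c d} = card {(a, b, c, d). R a b c d}"
  "card {(a, c, b, d). R a b c d} = card {(a, b, c, d). R a b c d}"
proof -
  show "card {(c, d, a, b). R a b c d} = card {(a, b, c, d). R a b c d}"
    by (rule bij_betw_same_card[of "\<lambda>(c, d, a, b). (a, b, c, d)"],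
        rule bij_betw_byWitness[where f' = "\<lambda>(a, b, c, d). (c, d, a, b)"]) auto
  show "card {(d, b, c, a). R a b c d} = card {(a, b, c, d). R a b c d}"
    by (rule bij_betw_same_card[of "\<lambda>(d, b, c, a). (a, b, c, d)"],
        rule bij_betw_byWitness[where f' = "\<lambda>(a, b, c, d). (d, b, c, a)"]) auto
  show "card {(d, a, b, c). R a b c d} = card {(a, b, c, d). R a b c d}"
    by (rule bij_betw_same_card[of "\<lambda>(d, a, b, c). (a, b, c, d)"],
        rule bij_betw_byWitness[where f' = "\<lambda>(a, b, c, d). (d, a, b, c)"]) auto
  show "card {(b, c, a, d). R a b c d} = card {(a, b, c, d). R a b c d}"
    by (rule bij_betw_same_card[of "\<lambda>(b, c, a, d). (a, b, c, d)"],
        rule bij_betw_byWitness[where f' = "\<lambda>(a, b, c, d). (b, c, a, d)"]) auto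
  show "card {(a, c, b, d). R a b c d} = card {(a, b, c, d). R a b c d}"
    by (rule bij_betw_same_card[of "\<lambda>(a, c, b, d). (a, b, c, d)"],
        rule bij_betw_byWitness[where f' = "\<lambda>(a, b, c, d). (a, c, b, d)"]) auto
qed

context conference_graph
begin

abbreviation adj :: "'a \<Rightarrow> 'a \<Rightarrow> bool" where
  "adj x y \<equiv> {x, y} \<in> edges G"

lemma adj_sym: "adj x y \<longleftrightarrow> adj y x"
  by (simp add: insert_commute)

lemma card_adjacent_pairs: "card {(x, y). adj x y} = CARD('a) * (2 * l + 2)"
proof -
  have "{(x, y). adj x y} = (SIGMA x:UNIV. {y. adj x y})" by auto
  then show ?thesis by (simp add: degree)
qed

lemma card_nonadjacent_pairs: "card {(x, y). x \<noteq> y \<and> \<not> adj x y} = CARD('a) * (2 * l + 2)"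
proof -
  have "card {y. x \<noteq> y \<and> \<not> adj x y} = 2 * l + 2" for x
  proof -
    have "{y. x \<noteq> y \<and> \<not> adj x y} = UNIV - insert x {y. adj x y}" by auto
    moreover have "card (insert x {y. adj x y}) = 2 * l + 3"
      using degree[of x] loopless[of x] by simp
    ultimately show ?thesis using order by (simp add: card_Diff_subset)
  qed
  moreover have "{(x, y). x \<noteq> y \<and> \<not> adj x y} = (SIGMA x:UNIV. {y. x \<noteq> y \<and> \<not> adj x y})" by auto
  ultimately show ?thesis by simp
qed

lemma adjacent_private:
  assumes "adj x y"
  shows "card {z. adj x z \<and> z \<noteq> y \<and> \<not> adj y z} = l + 1"
proof -
  have "{z. adj x z} = insert y ({z. adj x z \<and> adj y z} \<union> {z. adj x z \<and> z \<noteq> y \<and> \<not> adj y z})"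
    using assms by auto
  moreover have "card \<dots> = Suc (card ({z. adj x z \<and> adj y z} \<union> {z. adj x z \<and> z \<noteq> y \<and> \<not> adj y z}))"
    using loopless by (intro card_insert_disjoint) auto
  moreover have "card ({z. adj x z \<and> adj y z} \<union> {z. adj x z \<and> z \<noteq> y \<and> \<not> adj y z})
      = l + card {z. adj x z \<and> z \<noteq> y \<and> \<not> adj y z}"
    using adjacent_common[OF assms] by (subst card_Un_disjoint) auto
  ultimately show ?thesis using degree[of x] by simp
qed

text \<open>
  The base is an adjacent pair \<open>(c, d)\<close> in the positions \<open>2\<close>, \<open>3\<close>, together with two common
  neighbours \<open>a\<close>, \<open>b\<close>. In this and the next four equations the factor
  \<open>CARD('a) * (2 * l + 2)\<close> counts the base pairs, and the two summands correspond to the two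
  possibilities for the pair of further vertices.
\<close>

lemma complete_diamond_equation:
  "card (induced_quads G True True True True True True)
   + card (induced_quads G False True True True True True)
   = CARD('a) * (2 * l + 2) * (l * (l - 1))"
proof -
  let ?A = "\<lambda>c d. {z. adj c z \<and> adj d z}"
  have "induced_quads G True True True True True True \<union> induced_quads G False True True True True True
      = {(a, b, c, d). adj c d \<and> a \<in> ?A c d \<and> b \<in> ?A c d \<and> a \<noteq> b}"
    using loopless by (auto simp: induced_quads_def verts_UNIV adj_sym)
  moreover have "induced_quads G True True True True True True \<inter> induced_quads G False True True True True True = {}"
    by (auto simp: induced_quads_def)
  ultimately have "card (induced_quads G True True True True True True)
      + card (induced_quads G False True True True True True)
      = card {(a, b, c, d). adj c d \<and> a \<in> ?A c d \<and> b \<in> ?A c d \<and> a \<noteq> b}"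
    by (metis card_Un_disjoint finite)
  also have "\<dots> = card {(c, d, a, b). adj c d \<and> a \<in> ?A c d \<and> b \<in> ?A c d \<and> a \<noteq> b}"
    by (rule card_quadruples_reorder(1)[symmetric])
  also have "\<dots> = card {(x, y). adj x y} * (l * (l - 1))"
    using adjacent_common by (intro card_quadruples) (subst card_ordered_pairs; simp)
  finally show ?thesis by (simp only: card_adjacent_pairs)
qed

text \<open>
  The base is a non-adjacent pair with two common neighbours. If these are not adjacent, the quadruple
  is a 4-cycle with the missing pairs \<open>{0, 1}\<close> and \<open>{2, 3}\<close>; exchanging the positions \<open>1\<close> and \<open>2\<close>
  makes it the 4-cycle \<open>0, 1, 2, 3\<close>.
\<close>

lemma diamond_cycle_equation:
  "card (induced_quads G False True True True True True)
   + card (induced_quads G True False True True False True)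
   = CARD('a) * (2 * l + 2) * ((l + 1) * l)"
proof -
  let ?A = "\<lambda>c d. {z. adj c z \<and> adj d z}"
  have "induced_quads G True False True True False True =
    {(a, b, c, d). (a, c, b, d) \<in> induced_quads G False True True True True False}"
    by (auto simp: induced_quads_def adj_sym)
  then have "card (induced_quads G True False True True False True) =
    card {(a, b, c, d). (a, c, b, d) \<in> induced_quads G False True True True True False}" by simp
  also have "\<dots> = card (induced_quads G False True True True True False)"
    using card_quadruples_reorder(5)[of "\<lambda>a b c d. (a, b, c, d) \<in> induced_quads G False True True True True False"]
    by simp
  finally have "card (induced_quads G True False True True False True)
    = card (induced_quads G False True True True True False)" .
  moreover have "induced_quads G False True True True True True \<union> induced_quads G False True True True True False
      = {(a, b, c, d). (a \<noteq> b \<and> \<not> adj a b) \<and> c \<in> ?A a b \<and> d \<in> ?A a b \<and> c \<noteq> d}"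
    using loopless by (auto simp: induced_quads_def verts_UNIV adj_sym)
  moreover have "induced_quads G False True True True True True \<inter> induced_quads G False True True True True False = {}"
    by (auto simp: induced_quads_def)
  ultimately have "card (induced_quads G False True True True True True)
      + card (induced_quads G True False True True False True)
      = card {(a, b, c, d). (a \<noteq> b \<and> \<not> adj a b) \<and> c \<in> ?A a b \<and> d \<in> ?A a b \<and> c \<noteq> d}"
    by (metis card_Un_disjoint finite)
  also have "\<dots> = card {(x, y). x \<noteq> y \<and> \<not> adj x y} * ((l + 1) * l)"
    using nonadjacent_common by (intro card_quadruples) (subst card_ordered_pairs; simp)
  finally show ?thesis by (simp only: card_nonadjacent_pairs)
qed

text \<open>
  The base is an adjacent pair \<open>(d, b)\<close>, with a common neighbour \<open>c\<close> and a vertex \<open>a\<close> adjacent to \<open>d\<close>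
  but not to \<open>b\<close>. If \<open>a\<close> and \<open>c\<close> are not adjacent, then \<open>a\<close> is the pendant vertex of a paw.
\<close>

lemma diamond_paw_equation:
  "card (induced_quads G False True True True True True)
   + card (induced_quads G False False True True True True)
   = CARD('a) * (2 * l + 2) * (l * (l + 1))"
proof -
  let ?A = "\<lambda>c d. {z. adj c z \<and> adj d z}"
  let ?B = "\<lambda>c d. {z. adj c z \<and> z \<noteq> d \<and> \<not> adj d z}"
  have "induced_quads G False True True True True True \<union> induced_quads G False False True True True True
      = {(a, b, c, d). adj d b \<and> c \<in> ?A d b \<and> a \<in> ?B d b}"
    using loopless by (auto simp: induced_quads_def verts_UNIV adj_sym)
  moreover have "induced_quads G False True True True True True \<inter> induced_quads G False False True True True True = {}"
    by (auto simp: induced_quads_def)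
  ultimately have "card (induced_quads G False True True True True True)
      + card (induced_quads G False False True True True True)
      = card {(a, b, c, d). adj d b \<and> c \<in> ?A d b \<and> a \<in> ?B d b}"
    by (metis card_Un_disjoint finite)
  also have "\<dots> = card {(d, b, c, a). adj d b \<and> c \<in> ?A d b \<and> a \<in> ?B d b}"
    by (rule card_quadruples_reorder(2)[symmetric])
  also have "\<dots> = card {(x, y). adj x y} * (l * (l + 1))"
  proof (rule card_quadruples)
    fix x y assume "adj x y"
    moreover have "{(z, w). z \<in> ?A x y \<and> w \<in> ?B x y} = ?A x y \<times> ?B x y" by auto
    ultimately show "card {(z, w). z \<in> ?A x y \<and> w \<in> ?B x y} = l * (l + 1)"
      using adjacent_common adjacent_private by (simp only: card_cartesian_product)
  qed
  finally show ?thesis by (simp only: card_adjacent_pairs)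
qed

text \<open>
  The base is an adjacent pair \<open>(d, a)\<close> with two vertices \<open>b\<close>, \<open>c\<close> that are adjacent to \<open>d\<close> but not
  to \<open>a\<close>. If \<open>b\<close> and \<open>c\<close> are adjacent, this is a paw with pendant vertex \<open>a\<close>; if not, it is a
  claw with centre in the position \<open>3\<close>, which the exchange of
  the positions \<open>0\<close> and \<open>3\<close> brings into standard form.
\<close>

lemma paw_claw_equation:
  "card (induced_quads G False False True True True True)
   + card (induced_quads G True True True False False False)
   = CARD('a) * (2 * l + 2) * ((l + 1) * l)"
proof -
  let ?B = "\<lambda>c d. {z. adj c z \<and> z \<noteq> d \<and> \<not> adj d z}"
  have "induced_quads G True True True False False False =
    {(a, b, c, d). (d, b, c, a) \<in> induced_quads G False False True False True True}"
    by (auto simp: induced_quads_def adj_sym)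
  then have "card (induced_quads G True True True False False False) =
    card {(a, b, c, d). (d, b, c, a) \<in> induced_quads G False False True False True True}" by simp
  also have "\<dots> = card (induced_quads G False False True False True True)"
    using card_quadruples_reorder(2)[of "\<lambda>a b c d. (a, b, c, d) \<in> induced_quads G False False True False True True"]
    by simp
  finally have "card (induced_quads G True True True False False False)
    = card (induced_quads G False False True False True True)" .
  moreover have "induced_quads G False False True True True True \<union> induced_quads G False False True False True True
      = {(a, b, c, d). adj d a \<and> b \<in> ?B d a \<and> c \<in> ?B d a \<and> b \<noteq> c}"
    using loopless by (auto simp: induced_quads_def verts_UNIV adj_sym)
  moreover have "induced_quads G False False True True True True \<inter> induced_quads G False False True False True True = {}"
    by (auto simp: induced_quads_def)
  ultimately have "card (induced_quads G False False True True True True)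
      + card (induced_quads G True True True False False False)
      = card {(a, b, c, d). adj d a \<and> b \<in> ?B d a \<and> c \<in> ?B d a \<and> b \<noteq> c}"
    by (metis card_Un_disjoint finite)
  also have "\<dots> = card {(d, a, b, c). adj d a \<and> b \<in> ?B d a \<and> c \<in> ?B d a \<and> b \<noteq> c}"
    by (rule card_quadruples_reorder(3)[symmetric])
  also have "\<dots> = card {(x, y). adj x y} * ((l + 1) * l)"
    using adjacent_private by (intro card_quadruples) (subst card_ordered_pairs; simp)
  finally show ?thesis by (simp only: card_adjacent_pairs)
qed

text \<open>
  The base is the middle edge \<open>(b, c)\<close> of a path \<open>a, b, c, d\<close>, which is closed to a 4-cycle
  exactly if \<open>a\<close> and \<open>d\<close> are adjacent.
\<close>

lemma cycle_path_equation:
  "card (induced_quads G True False True True False True)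
   + card (induced_quads G True False False True False True)
   = CARD('a) * (2 * l + 2) * ((l + 1) * (l + 1))"
proof -
  let ?B = "\<lambda>c d. {z. adj c z \<and> z \<noteq> d \<and> \<not> adj d z}"
  have "induced_quads G True False True True False True \<union> induced_quads G True False False True False True
      = {(a, b, c, d). adj b c \<and> a \<in> ?B b c \<and> d \<in> ?B c b}"
    using loopless by (auto simp: induced_quads_def verts_UNIV adj_sym)
  moreover have "induced_quads G True False True True False True \<inter> induced_quads G True False False True False True = {}"
    by (auto simp: induced_quads_def)
  ultimately have "card (induced_quads G True False True True False True)
      + card (induced_quads G True False False True False True)
      = card {(a, b, c, d). adj b c \<and> a \<in> ?B b c \<and> d \<in> ?B c b}"
    by (metis card_Un_disjoint finite)
  also have "\<dots> = card {(b, c, a, d). adj b c \<and> a \<in> ?B b c \<and> d \<in> ?B c b}"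
    by (rule card_quadruples_reorder(4)[symmetric])
  also have "\<dots> = card {(x, y). adj x y} * ((l + 1) * (l + 1))"
  proof (rule card_quadruples)
    fix x y assume xy: "adj x y"
    have "{(z, w). z \<in> ?B x y \<and> w \<in> ?B y x} = ?B x y \<times> ?B y x" by auto
    then show "card {(z, w). z \<in> ?B x y \<and> w \<in> ?B y x} = (l + 1) * (l + 1)"
      using adjacent_private[OF xy] adjacent_private[OF xy[unfolded adj_sym[of x y]]]
      by (simp only: card_cartesian_product)
  qed
  finally show ?thesis by (simp only: card_adjacent_pairs)
qed

end

lemma (in conference_graph) card_induced_quads_patterns:
  "card (induced_quads G True True True True True True) = 24 * card (copies (complete_graph 4) G)"
  "card (induced_quads G False True True True True True) = 4 * card (copies diamond_graph G)"
  "card (induced_quads G False False True True True True) = 2 * card (copies paw_graph G)"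
  "card (induced_quads G True False True True False True) = 8 * card (copies (cycle_graph 4) G)"
  "card (induced_quads G True True True False False False) = 6 * card (copies (complete_bipartite_graph 1 3) G)"
  "card (induced_quads G True False False True False True) = 2 * card (copies (path_graph 4) G)"
proof -
  have *: "card (induced_quads G ({0, 1} \<in> edges H) ({0, 2} \<in> edges H) ({0, 3} \<in> edges H)
      ({1, 2} \<in> edges H) ({1, 3} \<in> edges H) ({2, 3} \<in> edges H))
    = card (embeddings H H) * card (copies H G)"
    if "verts H = {..<4}" "\<And>i. {i} \<notin> edges H" for H :: "nat sgraph"
    using card_embeddings_eq_card_quads[OF that loopless] card_embeddings[of H G] that(1) verts_UNIV by simp
  show "card (induced_quads G True True True True True True) = 24 * card (copies (complete_graph 4) G)"
    using *[OF verts_patterns(1) patterns_loopless(1)]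
    unfolding card_embeddings_self edges_patterns by (simp add: doubleton_eq_iff)
  show "card (induced_quads G False True True True True True) = 4 * card (copies diamond_graph G)"
    using *[OF verts_patterns(2) patterns_loopless(2)]
    unfolding card_embeddings_self edges_patterns by (simp add: doubleton_eq_iff)
  show "card (induced_quads G False False True True True True) = 2 * card (copies paw_graph G)"
    using *[OF verts_patterns(3) patterns_loopless(3)]
    unfolding card_embeddings_self edges_patterns by (simp add: doubleton_eq_iff)
  show "card (induced_quads G True False True True False True) = 8 * card (copies (cycle_graph 4) G)"
    using *[OF verts_patterns(4) patterns_loopless(4)]
    unfolding card_embeddings_self edges_patterns by (simp add: doubleton_eq_iff)
  show "card (induced_quads G True True True False False False) = 6 * card (copies (complete_bipartite_graph 1 3) G)"
    using *[OF verts_patterns(5) patterns_loopless(5)]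
    unfolding card_embeddings_self edges_patterns by (simp add: doubleton_eq_iff)
  show "card (induced_quads G True False False True False True) = 2 * card (copies (path_graph 4) G)"
    using *[OF verts_patterns(6) patterns_loopless(6)]
    unfolding card_embeddings_self edges_patterns by (simp add: doubleton_eq_iff)
qed

text \<open>
  The five equations form a triangular system: starting from the number of complete subgraphs they give
  the diamonds, from these the 4-cycles and the paws, and from these the paths and
  the claws.
\<close>

theorem (in conference_graph) conference_graph_four_vertex_counts:
  defines "q \<equiv> real CARD('a)" and "k \<equiv> real (card (copies (complete_graph 4) G))"
  shows "real (2 * card (copies diamond_graph G)) = 1 / 64 * q * (q - 1) * (q - 5) * (q - 9) - 12 * k"
    and "real (2 * card (copies paw_graph G)) = 1 / 4 * q * (q - 1) * (q - 5) + 24 * k"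
    and "real (2 * card (copies (cycle_graph 4) G)) = 1 / 16 * q * (q - 1) * (q - 5) + 6 * k"
    and "real (2 * card (copies (complete_bipartite_graph 1 3) G))
      = 1 / 96 * q * (q - 1) * (q - 5) * (q - 9) - 8 * k"
    and "real (card (copies (path_graph 4) G)) = 1 / 64 * q * (q - 1) * (q\<^sup>2 - 10 * q + 41) - 12 * k"
proof -
  define L where "L = real l"
  have q: "q = 4 * L + 5" by (simp add: q_def L_def order)
  have ll: "real (l * (l - 1)) = L * (L - 1)" by (cases l) (auto simp: L_def algebra_simps)
  note to_real = of_nat_add of_nat_mult of_nat_numeral of_nat_1
  let ?c = "\<lambda>H. real (card (copies H G))"
  have e: "24 * k + 4 * ?c diamond_graph = q * (2 * L + 2) * (L * (L - 1))"
    "4 * ?c diamond_graph + 8 * ?c (cycle_graph 4) = q * (2 * L + 2) * ((L + 1) * L)"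
    "4 * ?c diamond_graph + 2 * ?c paw_graph = q * (2 * L + 2) * (L * (L + 1))"
    "2 * ?c paw_graph + 6 * ?c (complete_bipartite_graph 1 3) = q * (2 * L + 2) * ((L + 1) * L)"
    "8 * ?c (cycle_graph 4) + 2 * ?c (path_graph 4) = q * (2 * L + 2) * ((L + 1) * (L + 1))"
    using complete_diamond_equation[unfolded card_induced_quads_patterns, THEN arg_cong[of _ _ real]]
      diamond_cycle_equation[unfolded card_induced_quads_patterns, THEN arg_cong[of _ _ real]]
      diamond_paw_equation[unfolded card_induced_quads_patterns, THEN arg_cong[of _ _ real]]
      paw_claw_equation[unfolded card_induced_quads_patterns, THEN arg_cong[of _ _ real]]
      cycle_path_equation[unfolded card_induced_quads_patterns, THEN arg_cong[of _ _ real]]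
    unfolding of_nat_mult[of _ "l * (l - 1)"] ll
    by (simp_all only: to_real k_def q_def L_def)
  \<comment> \<open>With the polynomial factors expressed in \<open>L\<close> and \<open>q\<close> left alone, all remaining
    steps are linear in the counts.\<close>
  have factors: "q - 1 = 4 * (L + 1)" "q - 5 = 4 * L" "q - 9 = 4 * (L - 1)"
    "q\<^sup>2 - 10 * q + 41 = 16 * (L\<^sup>2 + 1)"
    by (simp_all add: q power2_eq_square algebra_simps)
  note s = factors algebra_simps power2_eq_square
  show D: "real (2 * card (copies diamond_graph G)) = 1 / 64 * q * (q - 1) * (q - 5) * (q - 9) - 12 * k"
    using e(1) by (simp add: s)
  show C: "real (2 * card (copies (cycle_graph 4) G)) = 1 / 16 * q * (q - 1) * (q - 5) + 6 * k"
    using e(1,2) by (simp add: s)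
  show R: "real (2 * card (copies paw_graph G)) = 1 / 4 * q * (q - 1) * (q - 5) + 24 * k"
    using e(1,3) by (simp add: s)
  show "real (2 * card (copies (complete_bipartite_graph 1 3) G))
      = 1 / 96 * q * (q - 1) * (q - 5) * (q - 9) - 8 * k"
    using e(1,3,4) by (simp add: s)
  show "real (card (copies (path_graph 4) G)) = 1 / 64 * q * (q - 1) * (q\<^sup>2 - 10 * q + 41) - 12 * k"
    unfolding factors using e(1,2,5) by (simp add: algebra_simps power2_eq_square)
qed

section \<open>Symmetric self-complementary graphs\<close>

definition automorphism :: "'a sgraph \<Rightarrow> ('a \<Rightarrow> 'a) \<Rightarrow> bool" where
  "automorphism G f \<longleftrightarrow> bij_betw f (verts G) (verts G) \<and>
     (\<forall>x\<in>verts G. \<forall>y\<in>verts G. {f x, f y} \<in> edges G \<longleftrightarrow> {x, y} \<in> edges G)"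

lemma bij_image_eqI:
  assumes "bij f" "\<And>z. f z \<in> B \<longleftrightarrow> z \<in> A"
  shows "B = f ` A"
  using assms by (metis bij_is_surj image_subset_iff subsetI subset_antisym surj_def imageI)

text \<open>
  Vertex-transitivity gives a constant degree \<open>k\<close>, which self-complementarity forces to be half of the
  number of other vertices. Arc-transitivity gives a constant \<open>l\<close> for adjacent pairs. Every
  non-adjacent pair has \<open>l\<close> common non-neighbours, because the complementing permutation makes them
  common neighbours of an adjacent pair; inclusion and exclusion turn this into \<open>l + 1\<close> common
  neighbours. The walks of length two from a fixed vertex, counted by their end point, give
  \<open>k * k = k + k * l + k * (l + 1)\<close>.
\<close>

theorem arc_transitive_self_complementary_imp_conference_graph:
  fixes G :: "'a::finite sgraph"
  assumes V: "verts G = UNIV" and loopless: "\<And>x. {x} \<notin> edges G" and nontriv: "CARD('a) > 1"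
    and vtrans: "\<And>x y. \<exists>f. automorphism G f \<and> f x = y"
    and atrans: "\<And>x y u v. {x, y} \<in> edges G \<Longrightarrow> {u, v} \<in> edges G \<Longrightarrow>
      \<exists>f. automorphism G f \<and> f x = u \<and> f y = v"
    and sc: "graph_iso G (complement G)"
  obtains l where "conference_graph G l"
proof -
  define E where "E x y \<longleftrightarrow> {x, y} \<in> edges G" for x y
  have sym: "E x y \<longleftrightarrow> E y x" for x y by (simp add: E_def insert_commute)
  have irr: "\<not> E x x" for x using loopless by (simp add: E_def)
  define N where "N x = {z. E x z}" for x
  define c where "c x y = card (N x \<inter> N y)" for x y
  define k where "k = card (N undefined)"
  obtain t where t: "bij t" and tE: "\<And>x y. E (t x) (t y) \<longleftrightarrow> x \<noteq> y \<and> \<not> E x y"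
  proof -
    from sc obtain t where t: "bij t"
      and e: "\<And>x y. E x y \<longleftrightarrow> {t x, t y} \<in> edges (complement G)"
      by (auto simp: graph_iso_def V E_def)
    have "E (t x) (t y) \<longleftrightarrow> x \<noteq> y \<and> \<not> E x y" for x y
      using e[of x y] irr[of "t x"] bij_is_inj[OF t]
      by (auto simp: edge_complement_iff V E_def[symmetric] dest: injD)
    then show ?thesis using that t by blast
  qed
  have automorphism_iff: "automorphism G f \<longleftrightarrow> bij f \<and> (\<forall>x y. E (f x) (f y) \<longleftrightarrow> E x y)" for f
    by (simp add: automorphism_def V E_def)
  have N_image: "N (f x) = f ` N x" if "automorphism G f" for f x
  proof -
    have "bij f" "\<And>x y. E (f x) (f y) \<longleftrightarrow> E x y" using that by (auto simp: automorphism_iff)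
    then show ?thesis by (intro bij_image_eqI) (auto simp: N_def)
  qed
  have deg: "card (N x) = k" for x
  proof -
    obtain f where f: "automorphism G f" "f undefined = x" using vtrans by blast
    have "inj f" using f by (auto simp: automorphism_iff bij_def)
    then show ?thesis using N_image[OF f(1), of undefined] f(2)
      by (simp add: k_def card_image inj_on_subset)
  qed
  have order: "CARD('a) = 2 * k + 1"
  proof -
    have "card (N (t x)) = card {z. x \<noteq> z \<and> \<not> E x z}" for x
    proof -
      have "N (t x) = t ` {z. x \<noteq> z \<and> \<not> E x z}"
        by (rule bij_image_eqI[OF t]) (simp add: N_def tE)
      then show ?thesis using card_image[OF inj_on_subset[OF bij_is_inj[OF t]]] by simp
    qed
    moreover have "{z. x \<noteq> z \<and> \<not> E x z} = UNIV - insert x (N x)" for x by (auto simp: N_def)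
    moreover have "card (insert x (N x)) = Suc k" for x using irr deg by (simp add: N_def)
    moreover have "card (UNIV - insert x (N x)) + card (insert x (N x)) = CARD('a)" for x
      by (metis card_Diff_subset add.commute finite finite_code le_add_diff_inverse card_mono subset_UNIV)
    ultimately show ?thesis using deg by (metis add.commute add_Suc_right mult_2 Suc_eq_plus1)
  qed
  then have "k > 0" using nontriv by (cases k) auto
  then obtain x0 y0 where xy0: "E x0 y0"
    using deg by (metis N_def card.empty empty_Collect_eq less_numeral_extra(3))
  define l where "l = c x0 y0"
  have cadj: "c x y = l" if xy: "E x y" for x y
  proof -
    obtain f where f: "automorphism G f" "f x0 = x" "f y0 = y"
      using atrans[of x0 y0 x y] xy xy0 by (auto simp: E_def)
    then have inj: "inj f" by (auto simp: automorphism_iff bij_def)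
    have "N x \<inter> N y = f ` (N x0 \<inter> N y0)"
      using N_image[OF f(1), of x0] N_image[OF f(1), of y0] f inj by (simp add: image_Int)
    then show ?thesis using inj by (simp add: c_def l_def card_image inj_on_subset)
  qed
  have cnon: "c x y = l + 1" if ne: "x \<noteq> y" and xy: "\<not> E x y" for x y
  proof -
    have "E (t x) (t y)" using tE ne xy by simp
    then have "l = card (N (t x) \<inter> N (t y))" using cadj by (simp add: c_def)
    also have "N (t x) \<inter> N (t y) = t ` (UNIV - ({x, y} \<union> (N x \<union> N y)))"
      using ne xy by (intro bij_image_eqI[OF t]) (auto simp: N_def tE)
    also have "card \<dots> = card (UNIV - ({x, y} \<union> (N x \<union> N y)))"
      by (intro card_image inj_on_subset[OF bij_is_inj[OF t]]) auto
    also have "\<dots> = CARD('a) - card ({x, y} \<union> (N x \<union> N y))"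
      by (intro card_Diff_subset) auto
    finally have 1: "l = CARD('a) - card ({x, y} \<union> (N x \<union> N y))" .
    have 2: "card ({x, y} \<union> (N x \<union> N y)) = 2 + card (N x \<union> N y)"
      using ne xy irr sym by (subst card_Un_disjoint) (auto simp: N_def)
    have 3: "card (N x \<union> N y) + c x y = 2 * k"
      using card_Un_Int[of "N x" "N y"] deg by (simp add: c_def)
    have 4: "card ({x, y} \<union> (N x \<union> N y)) \<le> CARD('a)"
      by (intro card_mono) auto
    show ?thesis using 1 2 3 4 order by linarith
  qed
  \<comment> \<open>Walks of length two from \<open>x0\<close>, first by their middle vertex, then by their end.\<close>
  have "k * k = (\<Sum>y\<in>N x0. card (N y))" by (simp add: deg)
  also have "\<dots> = (\<Sum>y\<in>N x0. \<Sum>z\<in>UNIV. of_bool (E y z))"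
    by (intro sum.cong refl) (simp add: N_def)
  also have "\<dots> = (\<Sum>z\<in>UNIV. \<Sum>y\<in>N x0. of_bool (E y z))" by (rule sum.swap)
  also have "\<dots> = (\<Sum>z\<in>UNIV. c x0 z)"
    by (intro sum.cong refl) (auto simp: c_def N_def sym intro!: arg_cong[of _ _ card])
  also have "UNIV = {x0} \<union> N x0 \<union> (UNIV - insert x0 (N x0))" by auto
  also have "(\<Sum>z\<in>\<dots>. c x0 z) = c x0 x0 + (\<Sum>z\<in>N x0. c x0 z) + (\<Sum>z\<in>UNIV - insert x0 (N x0). c x0 z)"
    using irr by (subst sum.union_disjoint; (subst sum.union_disjoint)?) (auto simp: N_def)
  also have "(\<Sum>z\<in>N x0. c x0 z) = k * l"
    using cadj deg by (simp add: N_def)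
  also have "(\<Sum>z\<in>UNIV - insert x0 (N x0). c x0 z) = k * (l + 1)"
  proof -
    have "card (UNIV - insert x0 (N x0)) = k"
      using irr deg order by (subst card_Diff_subset) (auto simp: N_def)
    moreover have "(\<Sum>z\<in>UNIV - insert x0 (N x0). c x0 z) = (\<Sum>z\<in>UNIV - insert x0 (N x0). l + 1)"
      by (intro sum.cong refl cnon) (auto simp: N_def)
    ultimately show ?thesis by simp
  qed
  also have "c x0 x0 = k" by (simp add: c_def deg)
  finally have "k * k = k * (2 * l + 2)" by (simp add: algebra_simps)
  then have k: "k = 2 * l + 2" using \<open>k > 0\<close> by (simp only: mult_cancel1) simp
  have "conference_graph G l"
  proof
    show "CARD('a) = 4 * l + 5" using order k by simp
    show "card {z. {x, z} \<in> edges G} = 2 * l + 2" for x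
      using deg[of x] k by (simp add: N_def E_def)
    show "card {z. {x, z} \<in> edges G \<and> {y, z} \<in> edges G} = l" if "{x, y} \<in> edges G" for x y
      using cadj[of x y] that by (simp add: c_def N_def E_def Int_def)
    show "card {z. {x, z} \<in> edges G \<and> {y, z} \<in> edges G} = l + 1"
      if "x \<noteq> y" "{x, y} \<notin> edges G" for x y
      using cnon[of x y] that by (simp add: c_def N_def E_def Int_def)
  qed (use V loopless in auto)
  then show ?thesis by (rule that)
qed

definition cayley_graph :: "'a::ab_group_add set \<Rightarrow> 'a sgraph" where
  "cayley_graph S = \<lparr>verts = UNIV, edges = {{x, y} | x y. x \<noteq> y \<and> x - y \<in> S}\<rparr>"

lemma edge_cayley_graph_iff:
  assumes "0 \<notin> S" and "\<And>s. s \<in> S \<Longrightarrow> - s \<in> S"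
  shows "{x, y} \<in> edges (cayley_graph S) \<longleftrightarrow> x - y \<in> S"
proof -
  have "y - x \<in> S \<longleftrightarrow> x - y \<in> S" using assms(2)[of "x - y"] assms(2)[of "y - x"] by auto
  moreover have "x \<noteq> y" if "x - y \<in> S" using that assms(1) by auto
  ultimately show ?thesis by (simp add: cayley_graph_def doubleton_eq_iff) blast
qed

text \<open>
  Translations are automorphisms, so arcs can be moved to start from a common vertex and
  only the additive bijections that preserve \<open>S\<close> have to act transitively on \<open>S\<close>. Multiplication by
  \<open>c\<close> is the complementing permutation.
\<close>

lemma cayley_graph_conference:
  fixes S :: "'a::{field, finite} set"
  assumes zero: "0 \<notin> S" and neg: "\<And>s. s \<in> S \<Longrightarrow> - s \<in> S"
    and trans: "\<And>s t. s \<in> S \<Longrightarrow> t \<in> S \<Longrightarrow>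
      \<exists>h. bij h \<and> (\<forall>x y. h (x - y) = h x - h y) \<and> (\<forall>x. h x \<in> S \<longleftrightarrow> x \<in> S) \<and> h s = t"
    and c: "c \<noteq> 0" "\<And>x. x \<noteq> 0 \<Longrightarrow> c * x \<in> S \<longleftrightarrow> x \<notin> S"
  shows "graph_iso (cayley_graph S) (complement (cayley_graph S))"
    and "\<exists>l. conference_graph (cayley_graph S) l"
proof -
  note adj = edge_cayley_graph_iff[OF zero neg]
  have V: "verts (cayley_graph S) = UNIV" by (simp add: cayley_graph_def)
  have loopless: "{x} \<notin> edges (cayley_graph S)" for x using adj[of x x] zero by simp
  show sc: "graph_iso (cayley_graph S) (complement (cayley_graph S))"
    unfolding graph_iso_def verts_complement V
  proof (intro exI[of _ "\<lambda>x. c * x"] conjI ballI)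
    show "bij ((*) c)" by (rule bij_betw_byWitness[where f' = "\<lambda>x. x / c"]) (auto simp: c)
    fix x y
    have "c * x - c * y \<in> S \<longleftrightarrow> x - y \<notin> S" if "x \<noteq> y"
      using c(2)[of "x - y"] that by (simp add: right_diff_distrib)
    then show "({x, y} \<in> edges (cayley_graph S)) = ({c * x, c * y} \<in> edges (complement (cayley_graph S)))"
      using zero c(1) by (cases "x = y") (auto simp: edge_complement_iff V adj complement_loopless loopless)
  qed
  have vtrans: "\<exists>f. automorphism (cayley_graph S) f \<and> f x = y" for x y
  proof (intro exI[of _ "\<lambda>z. z + (y - x)"] conjI)
    have "bij (\<lambda>z. z + (y - x))"
      by (rule bij_betw_byWitness[where f' = "\<lambda>z. z - (y - x)"]) auto
    then show "automorphism (cayley_graph S) (\<lambda>z. z + (y - x))"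
      by (simp add: automorphism_def V adj)
  qed simp
  have atrans: "\<exists>f. automorphism (cayley_graph S) f \<and> f x = u \<and> f y = v"
    if xy: "{x, y} \<in> edges (cayley_graph S)" and uv: "{u, v} \<in> edges (cayley_graph S)" for x y u v
  proof -
    obtain h where h: "bij h" "\<And>x y. h (x - y) = h x - h y" "\<And>x. h x \<in> S \<longleftrightarrow> x \<in> S" "h (x - y) = u - v"
      using trans[of "x - y" "u - v"] xy uv by (auto simp: adj)
    have h0: "h 0 = 0" using h(2)[of 0 0] by simp
    have "bij (\<lambda>z. h (z - y) + v)"
      by (rule bij_betw_byWitness[where f' = "\<lambda>z. inv_into UNIV h (z - v) + y"])
         (auto simp: bij_is_inj bij_is_surj surj_f_inv_f h(1))
    moreover have "h (a - y) + v - (h (b - y) + v) \<in> S \<longleftrightarrow> a - b \<in> S" for a b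
      using h(3)[of "a - b"] by (simp add: h(2))
    ultimately have "automorphism (cayley_graph S) (\<lambda>z. h (z - y) + v)"
      by (simp add: automorphism_def V adj)
    then show ?thesis using h(4) h0 by (intro exI[of _ "\<lambda>z. h (z - y) + v"]) simp
  qed
  have "CARD('a) > 1"
    using card_mono[of "UNIV :: 'a set" "{0, 1}"] by simp
  then show "\<exists>l. conference_graph (cayley_graph S) l"
    using arc_transitive_self_complementary_imp_conference_graph[OF V loopless _ vtrans atrans sc] by blast
qed

section \<open>Powers of a primitive root\<close>

lemma ex_primitive_root: "\<exists>w :: 'a::{field, finite}. primitive_root w"
proof -
  interpret R: Ring.field "ring_of_type_algebra :: 'a ring" by (rule field_from_type_algebra)
  let ?R = "ring_of_type_algebra :: 'a ring"
  have "finite (carrier ?R)" by simp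
  then obtain w where w: "carrier (mult_of ?R) = {w [^]\<^bsub>?R\<^esub> i | i::nat. i \<in> UNIV}"
    using R.finite_field_mult_group_has_gen by auto
  have "w [^]\<^bsub>?R\<^esub> i = w ^ i" for i :: nat
    by (induction i) (simp_all add: ring_of_type_algebra_def nat_pow_def mult.commute)
  moreover have "carrier (mult_of ?R) = UNIV - {0}"
    by (simp add: ring_of_type_algebra_def)
  ultimately have "range (\<lambda>n. w ^ n) = UNIV - {0}" using w by auto
  then show ?thesis by (auto simp: primitive_root_def)
qed

text \<open>
  By the pigeonhole principle some power \<open>w ^ d\<close> with \<open>0 < d \<le> CARD('a) - 1\<close> equals \<open>1\<close>. Then \<open>w\<close>
  has at most \<open>d\<close> different powers, and these are all nonzero elements, so that
  \<open>d = CARD('a) - 1\<close> and the powers below \<open>d\<close> are distinct.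
\<close>

lemma primitive_root_power_eq_iff:
  fixes w :: "'a::{field, finite}"
  assumes "primitive_root w"
  shows "w ^ i = w ^ j \<longleftrightarrow> i mod (CARD('a) - 1) = j mod (CARD('a) - 1)"
proof -
  define n where "n = CARD('a) - 1"
  have range: "range (\<lambda>i::nat. w ^ i) = UNIV - {0}" using assms by (simp add: primitive_root_def)
  then have cardn: "card (range (\<lambda>i::nat. w ^ i)) = n" by (simp add: n_def)
  have w0: "w \<noteq> 0" using range by (metis DiffD2 power_one_right rangeI singletonI)
  have "\<not> inj_on (\<lambda>i. w ^ i) {..n}"
  proof
    assume "inj_on (\<lambda>i. w ^ i) {..n}"
    then have "card ((\<lambda>i. w ^ i) ` {..n}) = n + 1" by (simp add: card_image)
    moreover have "card ((\<lambda>i. w ^ i) ` {..n}) \<le> card (range (\<lambda>i. w ^ i))"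
      by (rule card_mono) auto
    ultimately show False using cardn by simp
  qed
  then obtain a b where ab: "a < b" "b \<le> n" "w ^ a = w ^ b"
    by (auto simp: inj_on_def) (metis linorder_neqE_nat)
  define d where "d = b - a"
  have d: "0 < d" "d \<le> n" "b = a + d" using ab by (auto simp: d_def)
  have wd: "w ^ d = 1" using ab(3) w0 by (simp add: d(3) power_add)
  have modd: "w ^ m = w ^ (m mod d)" for m
  proof -
    have "w ^ m = w ^ (d * (m div d) + m mod d)" by simp
    also have "\<dots> = w ^ (m mod d)" by (simp only: power_add power_mult wd) simp
    finally show ?thesis .
  qed
  have img: "range (\<lambda>i. w ^ i) = (\<lambda>i. w ^ i) ` {..<d}"
  proof (intro equalityI subsetI)
    fix x assume "x \<in> range (\<lambda>i. w ^ i)"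
    then obtain m where "x = w ^ (m mod d)" using modd by auto
    then show "x \<in> (\<lambda>i. w ^ i) ` {..<d}" using d(1) by auto
  qed auto
  then have "n \<le> d" using cardn card_image_le[of "{..<d}" "\<lambda>i. w ^ i"] by simp
  then have dn: "d = n" using d by simp
  have inj: "inj_on (\<lambda>i. w ^ i) {..<n}"
    using img cardn dn by (intro eq_card_imp_inj_on) auto
  have "w ^ i = w ^ j \<longleftrightarrow> w ^ (i mod n) = w ^ (j mod n)" using modd[of i] modd[of j] dn by simp
  also have "\<dots> \<longleftrightarrow> i mod n = j mod n"
    using inj_on_eq_iff[OF inj, of "i mod n" "j mod n"] d(1) dn by simp
  finally show ?thesis by (simp add: n_def)
qed

lemma primitive_root_half_power:
  fixes w :: "'a::{field, finite}"
  assumes w: "primitive_root w" and "even (CARD('a) - 1)"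
  shows "w ^ ((CARD('a) - 1) div 2) = -1"
proof -
  have "CARD('a) \<ge> 2"
    using card_mono[of "UNIV :: 'a set" "{0, 1}"] by simp
  define n where "n = CARD('a) - 1"
  have n: "n > 0" "even n" using assms \<open>CARD('a) \<ge> 2\<close> by (auto simp: n_def)
  have "(w ^ (n div 2))\<^sup>2 = w ^ n" using n by (simp flip: power_mult)
  also have "\<dots> = w ^ 0" using primitive_root_power_eq_iff[OF w, of n 0] by (simp add: n_def)
  finally have "(w ^ (n div 2))\<^sup>2 = 1" by simp
  moreover have "w ^ (n div 2) \<noteq> w ^ 0"
  proof -
    have "n div 2 mod n = n div 2" "n div 2 \<noteq> 0" using n by auto
    then show ?thesis
      using primitive_root_power_eq_iff[OF w, of "n div 2" 0, folded n_def] by simp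
  qed
  ultimately show ?thesis by (auto simp: power2_eq_1_iff n_def)
qed

text \<open>
  The union of the cosets \<open>w ^ t\<close> times the fourth powers, \<open>t \<in> T\<close>, if \<open>w\<close> is a primitive root and \<open>4\<close>
  divides \<open>CARD('a) - 1\<close>.
\<close>

definition power_class :: "'a::field \<Rightarrow> nat set \<Rightarrow> 'a set" where
  "power_class w T = {w ^ j | j. j mod 4 \<in> T}"

context
  fixes w :: "'a::{field, finite}"
  assumes w: "primitive_root w" and four: "4 dvd CARD('a) - 1"
begin

lemma primitive_root_nonzero: "w ^ i \<noteq> 0"
proof -
  have "w ^ i \<in> range (\<lambda>i. w ^ i)" by (rule rangeI)
  then have "w ^ i \<in> UNIV - {0}" using w by (simp only: primitive_root_def)
  then show ?thesis by (simp only: Diff_iff singleton_iff) simp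
qed

lemma nonzero_eq_power: "x \<noteq> 0 \<Longrightarrow> \<exists>i. x = w ^ i"
proof -
  assume "x \<noteq> 0"
  then have "x \<in> range (\<lambda>i::nat. w ^ i)" using w by (simp add: primitive_root_def)
  then show ?thesis by auto
qed

text \<open>
  The exponent of a power of \<open>w\<close> is determined modulo \<open>CARD('a) - 1\<close>, hence also modulo its divisor \<open>4\<close>.
\<close>

lemma power_in_power_class_iff: "w ^ i \<in> power_class w T \<longleftrightarrow> i mod 4 \<in> T"
proof -
  have eq: "i mod 4 = j mod 4" if "w ^ i = w ^ j" for j
  proof -
    from that have "i mod (CARD('a) - 1) = j mod (CARD('a) - 1)"
      by (simp only: primitive_root_power_eq_iff[OF w])
    then have "i mod (CARD('a) - 1) mod 4 = j mod (CARD('a) - 1) mod 4" by (rule arg_cong)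
    then show ?thesis by (simp only: mod_mod_cancel[OF four])
  qed
  show ?thesis
  proof
    assume "w ^ i \<in> power_class w T"
    then obtain j where "w ^ i = w ^ j" "j mod 4 \<in> T" unfolding power_class_def by blast
    then show "i mod 4 \<in> T" by (simp only: eq)
  next
    assume "i mod 4 \<in> T"
    then show "w ^ i \<in> power_class w T" unfolding power_class_def by blast
  qed
qed

lemma power_classE:
  assumes "s \<in> power_class w T"
  obtains i where "s = w ^ i" "i mod 4 \<in> T"
  using assms unfolding power_class_def by blast

lemma zero_notin_power_class: "0 \<notin> power_class w T"
  using primitive_root_nonzero by (auto simp: power_class_def)

lemma card_minus_one: obtains m where "CARD('a) - 1 = 4 * m" "m > 0"
proof -
  have "CARD('a) \<ge> 2"
    using card_mono[of "UNIV :: 'a set" "{0, 1}"] by simp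
  then show ?thesis using four that by (elim dvdE) auto
qed

text \<open>
  The map is \<open>x \<mapsto> w ^ k * x ^ e\<close>, where \<open>e = 1\<close> or \<open>e\<close> is the characteristic in the applications. To send \<open>w ^ i\<close> to \<open>w ^ j\<close>
  the exponent \<open>k\<close> has to be \<open>j - e * i\<close> modulo \<open>CARD('a) - 1\<close>, which is a multiple of \<open>4\<close>; modulo \<open>4\<close>
  this is \<open>j + e * i * 3\<close>. On exponents the map acts as \<open>m \<mapsto> k + e * m\<close>.
\<close>

lemma twisted_dilation:
  assumes e: "\<And>x y :: 'a. (x - y) ^ e = x ^ e - y ^ e" "e > 0"
    and T: "\<And>m. (j + e * i * 3 + e * m) mod 4 \<in> T \<longleftrightarrow> m mod 4 \<in> T"
  shows "\<exists>h. bij h \<and> (\<forall>x y. h (x - y) = h x - h y) \<and>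
    (\<forall>x. h x \<in> power_class w T \<longleftrightarrow> x \<in> power_class w T) \<and> h (w ^ i) = w ^ j"
proof -
  obtain m where m: "CARD('a) - 1 = 4 * m" "m > 0" by (rule card_minus_one)
  \<comment> \<open>The factor \<open>4 * m - 1\<close> stands for \<open>- 1\<close> modulo \<open>4 * m\<close>.\<close>
  define k where "k = j + e * i * (4 * m - 1)"
  define h where "h x = w ^ k * x ^ e" for x
  have hpow: "h (w ^ a) = w ^ (k + e * a)" for a
    by (simp only: h_def power_add power_mult[of w a e, symmetric] mult.commute[of a e])
  have hdiff: "h (x - y) = h x - h y" for x y by (simp add: h_def e(1) right_diff_distrib)
  have "inj h"
  proof (rule injI)
    fix x y assume "h x = h y"
    then have "h (x - y) = 0" by (simp add: hdiff)
    then have "(x - y) ^ e = 0"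
      using primitive_root_nonzero[of k] by (simp only: h_def mult_eq_0_iff) blast
    then show "x = y" by simp
  qed
  then have "bij h" by (simp add: bij_def finite_UNIV_inj_surj)
  moreover have "h x \<in> power_class w T \<longleftrightarrow> x \<in> power_class w T" for x
  proof (cases "x = 0")
    case True
    then show ?thesis using e(2) zero_notin_power_class by (simp add: h_def power_0_left)
  next
    case False
    then obtain a where a: "x = w ^ a" using nonzero_eq_power by blast
    have "k + e * a = (j + e * i * 3 + e * a) + 4 * (e * i * (m - 1))"
      using m(2) by (cases m) (auto simp: k_def algebra_simps)
    then have "(k + e * a) mod 4 = (j + e * i * 3 + e * a) mod 4" by (simp only: mod_mult_self2)
    then show ?thesis
      using T[of a] by (simp only: a hpow power_in_power_class_iff)
  qed
  moreover have "h (w ^ i) = w ^ j"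
  proof -
    have "k + e * i = j + e * i * (4 * m)"
      using m(2) by (cases m) (auto simp: k_def algebra_simps)
    then have "w ^ (k + e * i) = w ^ j"
      by (simp only: primitive_root_power_eq_iff[OF w] m(1) mod_mult_self1)
    then show ?thesis by (simp only: hpow)
  qed
  ultimately show ?thesis using hdiff by blast
qed

text \<open>Negation adds \<open>(CARD('a) - 1) div 2\<close> to the exponent.\<close>

lemma power_class_uminus:
  assumes T: "\<And>i. (i + (CARD('a) - 1) div 2) mod 4 \<in> T \<longleftrightarrow> i mod 4 \<in> T"
    and s: "s \<in> power_class w T"
  shows "- s \<in> power_class w T"
proof -
  have "even (CARD('a) - 1)" using four by (rule dvd_trans[rotated]) simp
  note half = primitive_root_half_power[OF w this]
  obtain i where i: "s = w ^ i" "i mod 4 \<in> T" using s by (auto simp: power_class_def)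
  have "- s = w ^ (i + (CARD('a) - 1) div 2)" by (simp only: i power_add half) simp
  then show ?thesis using T[of i] i by (simp only: power_in_power_class_iff)
qed

lemma power_class_swap:
  assumes T: "\<And>i. (k + i) mod 4 \<in> T \<longleftrightarrow> i mod 4 \<notin> T" and x: "x \<noteq> 0"
  shows "w ^ k * x \<in> power_class w T \<longleftrightarrow> x \<notin> power_class w T"
proof -
  obtain i where i: "x = w ^ i" using nonzero_eq_power[OF x] by blast
  have "w ^ k * x = w ^ (k + i)" by (simp add: i power_add)
  then show ?thesis using T[of i] i by (simp only: power_in_power_class_iff)
qed

section \<open>Paley and Peisert graphs\<close>

lemma paley_graph_eq_cayley_graph: "paley_graph = cayley_graph (power_class w {0, 2})"
proof -
  have "quadratic_residue a \<longleftrightarrow> a \<in> power_class w {0, 2}" for a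
  proof
    assume "quadratic_residue a"
    then obtain z where z: "a = z\<^sup>2" "z \<noteq> 0" by (auto simp: quadratic_residue_def)
    then obtain i where "z = w ^ i" using nonzero_eq_power by blast
    then have "a = w ^ (i * 2)" using z(1) by (simp only: power_mult)
    moreover have "i * 2 mod 4 \<in> {0, 2}" unfolding insert_iff empty_iff by presburger
    ultimately show "a \<in> power_class w {0, 2}" by (simp only: power_in_power_class_iff)
  next
    assume "a \<in> power_class w {0, 2}"
    then obtain j where j: "a = w ^ j" "j mod 4 \<in> {0, 2}" by (auto simp: power_class_def)
    then have "even j" unfolding insert_iff empty_iff by presburger
    then have "j = j div 2 * 2" by simp
    then have "a = (w ^ (j div 2))\<^sup>2" using j(1) by (metis power_mult)
    moreover have "a \<noteq> 0" using j(1) primitive_root_nonzero[of j] by (simp only: not_False_eq_True)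
    ultimately show "quadratic_residue a" unfolding quadratic_residue_def by blast
  qed
  then show ?thesis by (simp add: paley_graph_def cayley_graph_def)
qed

lemma peisert_graph_eq_cayley_graph: "peisert_graph w = cayley_graph (power_class w {0, 1})"
proof -
  have "(\<exists>j::nat. ([j = 0] (mod 4) \<or> [j = 1] (mod 4)) \<and> a = w ^ j) \<longleftrightarrow> a \<in> power_class w {0, 1}" for a
  proof -
    have "[j = 0] (mod 4) \<or> [j = 1] (mod 4) \<longleftrightarrow> j mod 4 \<in> {0, 1}" for j :: nat
      by (simp add: cong_def)
    then show ?thesis by (simp only: power_class_def mem_Collect_eq conj_commute)
  qed
  then show ?thesis by (simp add: peisert_graph_def cayley_graph_def)
qed

text \<open>Exponents of squares are even, and both negation and multiplication by squares preserve their parity.\<close>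

lemma paley_graph_conference:
  "graph_iso (paley_graph :: 'a sgraph) (complement (paley_graph :: 'a sgraph))"
  "\<exists>l. conference_graph (paley_graph :: 'a sgraph) l"
proof -
  let ?S = "power_class w {0, 2}"
  have T: "i mod 4 \<in> {0, 2} \<longleftrightarrow> even i" for i :: nat
    unfolding insert_iff empty_iff by presburger
  obtain m where m: "CARD('a) - 1 = 4 * m" by (rule card_minus_one)
  have neg: "- s \<in> ?S" if "s \<in> ?S" for s
    using that by (intro power_class_uminus) (simp_all only: T m, simp)
  have trans: "\<exists>h. bij h \<and> (\<forall>x y. h (x - y) = h x - h y) \<and> (\<forall>x. h x \<in> ?S \<longleftrightarrow> x \<in> ?S) \<and> h s = t"
    if st: "s \<in> ?S" "t \<in> ?S" for s t
  proof -
    obtain i where i: "s = w ^ i" "i mod 4 \<in> {0, 2}" using st(1) by (rule power_classE)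
    obtain j where j: "t = w ^ j" "j mod 4 \<in> {0, 2}" using st(2) by (rule power_classE)
    from i j have ij: "s = w ^ i" "even i" "t = w ^ j" "even j" by (simp_all only: T)
    show ?thesis unfolding ij(1,3)
      by (rule twisted_dilation[where e = 1]) (use ij in \<open>simp_all only: T, simp_all\<close>)
  qed
  have nz: "w ^ 1 \<noteq> 0" by (rule primitive_root_nonzero)
  have swap: "w ^ 1 * x \<in> ?S \<longleftrightarrow> x \<notin> ?S" if "x \<noteq> 0" for x
    by (rule power_class_swap[OF _ that]) (simp only: T, simp)
  show "graph_iso (paley_graph :: 'a sgraph) (complement (paley_graph :: 'a sgraph))"
    unfolding paley_graph_eq_cayley_graph
    by (rule cayley_graph_conference(1)[OF zero_notin_power_class neg trans nz swap])
  show "\<exists>l. conference_graph (paley_graph :: 'a sgraph) l"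
    unfolding paley_graph_eq_cayley_graph
    by (rule cayley_graph_conference(2)[OF zero_notin_power_class neg trans nz swap])
qed

text \<open>
  Fourth powers act transitively on each of the two classes of exponents \<open>0\<close> and \<open>1\<close> modulo \<open>4\<close>. To
  pass from one to the other, a Frobenius map is used: with \<open>CHAR('a) mod 4 = 3\<close> the exponents undergo
  \<open>m \<mapsto> 1 - m\<close> modulo \<open>4\<close>, which exchanges \<open>0\<close> with \<open>1\<close> and \<open>2\<close> with \<open>3\<close>. That \<open>8\<close> divides
  \<open>CARD('a) - 1\<close> makes negation preserve the exponents modulo \<open>4\<close>.
\<close>

lemma peisert_graph_conference:
  assumes p: "CHAR('a) mod 4 = 3" and eight: "8 dvd CARD('a) - 1"
  shows "graph_iso (peisert_graph w) (complement (peisert_graph w))"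
    and "\<exists>l. conference_graph (peisert_graph w) l"
proof -
  let ?S = "power_class w {0, 1}"
  let ?p = "CHAR('a)"
  have prime: "prime ?p"
    using prime_CHAR_semidom[where ?'a = 'a] finite_imp_CHAR_pos[where ?'a = 'a] by simp
  have frob: "(x - y) ^ ?p = x ^ ?p - y ^ ?p" for x y :: 'a
  proof -
    have "(x - y + y) ^ ?p = (x - y) ^ ?p + y ^ ?p"
      using prime by (rule freshmans_dream) simp
    then show ?thesis by simp
  qed
  obtain m where m: "CARD('a) - 1 = 8 * m" using eight by (elim dvdE)
  have half: "(i + (CARD('a) - 1) div 2) mod 4 = i mod 4" for i
    using m by simp
  have neg: "- s \<in> ?S" if "s \<in> ?S" for s
    using that by (intro power_class_uminus) (simp_all only: half)
  have trans: "\<exists>h. bij h \<and> (\<forall>x y. h (x - y) = h x - h y) \<and> (\<forall>x. h x \<in> ?S \<longleftrightarrow> x \<in> ?S) \<and> h s = t"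
    if st: "s \<in> ?S" "t \<in> ?S" for s t
  proof -
    obtain i where i: "s = w ^ i" "i mod 4 \<in> {0, 1}" using st(1) by (rule power_classE)
    obtain j where j: "t = w ^ j" "j mod 4 \<in> {0, 1}" using st(2) by (rule power_classE)
    from i j have ij: "s = w ^ i" "i mod 4 = 0 \<or> i mod 4 = 1" "t = w ^ j" "j mod 4 = 0 \<or> j mod 4 = 1"
      by blast+
    show ?thesis
    proof (cases "i mod 4 = j mod 4")
      case True
      obtain u v c where uv: "i = 4 * u + c" "j = 4 * v + c"
        using mult_div_mod_eq[of 4 i] mult_div_mod_eq[of 4 j] True by metis
      have "j + i * 3 + a = a + 4 * (v + 3 * u + c)" for a by (simp add: uv)
      then have "(j + i * 3 + a) mod 4 = a mod 4" for a by (simp only: mod_mult_self2)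
      then have "(j + 1 * i * 3 + 1 * a) mod 4 \<in> {0, 1} \<longleftrightarrow> a mod 4 \<in> {0, 1}" for a
        by (simp only: mult_1)
      then show ?thesis unfolding ij(1,3) by (intro twisted_dilation[where e = 1]) simp_all
    next
      case False
      then have "j mod 4 + i mod 4 = 1" using ij(2,4) by auto
      then obtain u v c d where uv: "i = 4 * u + c" "j = 4 * v + d" "d + c = 1"
        using mult_div_mod_eq[of 4 i] mult_div_mod_eq[of 4 j] by metis
      define b where "b = ?p div 4"
      have b: "?p = 4 * b + 3" using p by (simp add: b_def) presburger
      have "(j + ?p * i * 3 + ?p * a) mod 4 \<in> {0, 1} \<longleftrightarrow> a mod 4 \<in> {0, 1}" for a
      proof -
        have "j + ?p * i * 3 + ?p * a = (j + 9 * i + 3 * a) + 4 * (b * (3 * i + a))"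
          by (simp add: b algebra_simps)
        then have "(j + ?p * i * 3 + ?p * a) mod 4 = (j + 9 * i + 3 * a) mod 4"
          by (simp only: mod_mult_self2)
        also have "j + 9 * i + 3 * a = (1 + 3 * (a mod 4)) + 4 * (v + 9 * u + 2 * c + 3 * (a div 4))"
        proof -
          have "a = 4 * (a div 4) + a mod 4" by simp
          then have "3 * a = 3 * (a mod 4) + 4 * (3 * (a div 4))" by linarith
          then show ?thesis using uv by simp
        qed
        also have "\<dots> mod 4 = (1 + 3 * (a mod 4)) mod 4" by (simp only: mod_mult_self2)
        also have "(1 + 3 * (a mod 4)) mod 4 \<in> {0, 1} \<longleftrightarrow> a mod 4 \<in> {0, 1}"
        proof -
          have "a mod 4 < 4" by simp
          then consider "a mod 4 = 0" | "a mod 4 = 1" | "a mod 4 = 2" | "a mod 4 = 3" by linarith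
          then show ?thesis by cases simp_all
        qed
        finally show ?thesis .
      qed
      then show ?thesis unfolding ij(1,3)
        using prime frob by (intro twisted_dilation[where e = ?p]) (simp_all add: prime_gt_0_nat)
    qed
  qed
  have nz: "w ^ 2 \<noteq> 0" by (rule primitive_root_nonzero)
  have swap: "w ^ 2 * x \<in> ?S \<longleftrightarrow> x \<notin> ?S" if "x \<noteq> 0" for x
    by (rule power_class_swap[OF _ that]) (unfold insert_iff empty_iff, presburger)
  show "graph_iso (peisert_graph w) (complement (peisert_graph w))"
    unfolding peisert_graph_eq_cayley_graph
    by (rule cayley_graph_conference(1)[OF zero_notin_power_class neg trans nz swap])
  show "\<exists>l. conference_graph (peisert_graph w) l"
    unfolding peisert_graph_eq_cayley_graph
    by (rule cayley_graph_conference(2)[OF zero_notin_power_class neg trans nz swap])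
qed

end

theorem theorem1p3:
  fixes p q r k4 :: nat
    and G :: "'a::{field, finite} sgraph"
  assumes "prime p" and "r > 0" and "q = p ^ r" and "[q = 1] (mod 4)"
    and "CARD('a) = q"
    and "G = paley_graph \<or>
         (even r \<and> [p = 3] (mod 4) \<and> (\<exists>w. primitive_root w \<and> G = peisert_graph w))"
    and "k4 = card (copies (complete_graph 4) G)"
  shows "
     (card (sym_copies (complete_graph 4) G) = 2 * card (copies (complement (complete_graph 4)) G)
       \<and> 2 * card (copies (complement (complete_graph 4)) G) = 2 * k4)
   \<and> (card (sym_copies diamond_graph G) = 2 * card (copies diamond_graph G)
       \<and> 2 * card (copies diamond_graph G) = 2 * card (copies (complement diamond_graph) G)
       \<and> real (2 * card (copies (complement diamond_graph) G))
          = 1 / 64 * real q * (real q - 1) * (real q - 5) * (real q - 9) - 12 * real k4)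
   \<and> (card (sym_copies paw_graph G) = 2 * card (copies paw_graph G)
       \<and> 2 * card (copies paw_graph G) = 2 * card (copies (complement paw_graph) G)
       \<and> real (2 * card (copies (complement paw_graph) G))
          = 1 / 4 * real q * (real q - 1) * (real q - 5) + 24 * real k4)
   \<and> (card (sym_copies (cycle_graph 4) G) = 2 * card (copies (cycle_graph 4) G)
       \<and> 2 * card (copies (cycle_graph 4) G) = 2 * card (copies (complement (cycle_graph 4)) G)
       \<and> real (2 * card (copies (complement (cycle_graph 4)) G))
          = 1 / 16 * real q * (real q - 1) * (real q - 5) + 6 * real k4)
   \<and> (card (sym_copies (complete_bipartite_graph 1 3) G)
          = 2 * card (copies (complete_bipartite_graph 1 3) G)
       \<and> 2 * card (copies (complete_bipartite_graph 1 3) G)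
          = 2 * card (copies (complement (complete_bipartite_graph 1 3)) G)
       \<and> real (2 * card (copies (complement (complete_bipartite_graph 1 3)) G))
          = 1 / 96 * real q * (real q - 1) * (real q - 5) * (real q - 9) - 8 * real k4)
   \<and> (card (sym_copies (path_graph 4) G) = card (copies (path_graph 4) G)
       \<and> real (card (copies (path_graph 4) G))
          = 1 / 64 * real q * (real q - 1) * ((real q)\<^sup>2 - 10 * real q + 41) - 12 * real k4)"
proof -
  have q: "CARD('a) = p ^ r" "[CARD('a) = 1] (mod 4)"
    using assms(3,4,5) by simp_all
  have "CARD('a) \<ge> 1" using zero_less_card_finite by (simp add: Suc_le_eq)
  have four: "4 dvd CARD('a) - 1"
    using q(2) cong_altdef_nat[OF \<open>CARD('a) \<ge> 1\<close>, of 4] by simp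
  have "graph_iso G (complement G) \<and> (\<exists>l. conference_graph G l)"
    using assms(6)
  proof (elim disjE conjE exE)
    assume G: "G = paley_graph"
    obtain w :: 'a where "primitive_root w" using ex_primitive_root by blast
    then show ?thesis unfolding G using four by (intro conjI paley_graph_conference)
  next
    fix w assume w: "primitive_root w" "G = peisert_graph w" and r: "even r" and p: "[p = 3] (mod 4)"
    have "CHAR('a) dvd p ^ r" using CHAR_dvd_CARD[where ?'a = 'a] q(1) by simp
    moreover have "prime CHAR('a)"
      using prime_CHAR_semidom[where ?'a = 'a] finite_imp_CHAR_pos[where ?'a = 'a] by simp
    ultimately have "CHAR('a) = p"
      using assms(1) by (metis prime_dvd_power primes_dvd_imp_eq)
    then have "CHAR('a) mod 4 = 3" using p by (simp add: cong_def)
    moreover have "8 dvd CARD('a) - 1"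
    proof -
      obtain b where b: "p = 4 * b + 3"
        using p mult_div_mod_eq[of 4 p] by (auto simp: cong_def) metis
      have "p ^ 2 = 1 + 8 * (2 * b ^ 2 + 3 * b + 1)"
        by (simp add: b power2_eq_square algebra_simps)
      then have "[p ^ 2 = 1] (mod 8)" by (simp only: cong_def mod_mult_self2)
      then have "[(p ^ 2) ^ (r div 2) = 1 ^ (r div 2)] (mod 8)" by (rule cong_pow)
      moreover have "(p ^ 2) ^ (r div 2) = CARD('a)" using r q(1) by (simp flip: power_mult)
      ultimately have "[CARD('a) = 1] (mod 8)" by simp
      then show ?thesis using cong_altdef_nat[OF \<open>CARD('a) \<ge> 1\<close>, of 8] by simp
    qed
    ultimately show ?thesis
      unfolding w(2) using w(1) four by (intro conjI peisert_graph_conference)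
  qed
  then obtain l where sc: "graph_iso G (complement G)" and "conference_graph G l" by blast
  then interpret conference_graph G l by blast
  have fin: "finite (verts G)" by simp
  note compl = card_copies_complement[OF sc loopless]
  note sym = card_sym_copies[OF fin sc loopless]
  note counts = conference_graph_four_vertex_counts[unfolded assms(5)]
  have sym_patterns: "card (sym_copies (complete_graph 4) G) = 2 * card (copies (complete_graph 4) G)"
    "card (sym_copies diamond_graph G) = 2 * card (copies diamond_graph G)"
    "card (sym_copies paw_graph G) = 2 * card (copies paw_graph G)"
    "card (sym_copies (cycle_graph 4) G) = 2 * card (copies (cycle_graph 4) G)"
    "card (sym_copies (complete_bipartite_graph 1 3) G) = 2 * card (copies (complete_bipartite_graph 1 3) G)"
    by (intro sym patterns_loopless claw_not_self_complementary not_self_complementary_if_card_arcs;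
        simp only: verts_patterns card_arcs_patterns; simp)+
  \<comment> \<open>The two families of copies coincide here, which accounts for the missing factor \<open>2\<close>.\<close>
  have sym_path: "sym_copies (path_graph 4) G = copies (path_graph 4) G"
    unfolding sym_copies_def copies_cong_iso[OF path_graph_4_self_complementary, symmetric] by simp
  show ?thesis
    unfolding assms(7)
    by (simp only: sym_patterns sym_path compl[OF patterns_loopless(1)] compl[OF patterns_loopless(2)]
        compl[OF patterns_loopless(3)] compl[OF patterns_loopless(4)] compl[OF patterns_loopless(5)]
        counts simp_thms)
qed

end
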